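(* Let $n\ge 2$ be an integer, let $a,b\in\mathbb{R}$ with $a\neq -n$ and $b\neq -n$, and let $p,q>1$ satisfy $$\frac{a+n}{p}+\frac{b+n}{q}=n-2\qquad\text{and}\qquad \frac1p+\frac1q<1 .$$ Then the system $$-\Delta u=|x|^a|v|^{p-2}v,\qquad -\Delta v=|x|^{b}|u|^{q-2}u\qquad\text{on }\mathbb{R}^n\setminus\{0\}$$ has a nontrivial radially symmetric solution $u,v$ such that $$\int_{\mathbb{R}^n}|x|^{-\frac{a}{p-1}}|\Delta u|^{p'}\,dx<\infty,\qquad \int_{\mathbb{R}^n}|x|^{-\frac{b}{q-1}}|\Delta v|^{q'}\,dx<\infty .$$ Moreover, it holds that $$\lim_{|x|\to \infty}|x|^{\frac{b+n}{q}} u(x)=\lim_{x\to 0}|x|^{\frac{b+n}{q}} u(x)=\lim_{|x|\to \infty}|x|^{\frac{a+n}{p}}v(x)=\lim_{x\to 0}|x|^{\frac{a+n}{p}}v(x)=0,$$ and $u$, $v$ are both positive if and only if $a>-n$ and $b>-n$.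
   Context: Here $p'=\frac{p}{p-1}$ and $q'=\frac{q}{q-1}$. A radially symmetric solution is a pair of radial functions $u,v\in C^2(\mathbb{R}^n\setminus\{0\})$ satisfying both equations pointwise on $\mathbb{R}^n\setminus\{0\}$; nontrivial means $(u,v)\not\equiv(0,0)$. The expression $|t|^{r-2}t$ with $r>1$ is understood to be $0$ at $t=0$. *)

theory Defs
  imports "HOL-Analysis.Analysis"
begin

definition partial_deriv :: "'a::euclidean_space \<Rightarrow> ('a \<Rightarrow> real) \<Rightarrow> 'a \<Rightarrow> real" where
  "partial_deriv i f x = deriv (\<lambda>t. f (x + t *\<^sub>R i)) 0"

text \<open>The next two notions are meant for open \<open>S\<close> only.\<close>

definition C1_on :: "'a::euclidean_space set \<Rightarrow> ('a \<Rightarrow> real) \<Rightarrow> bool" where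
  "C1_on S f \<longleftrightarrow> (\<forall>i\<in>Basis.
      (\<forall>x\<in>S. (\<lambda>t. f (x + t *\<^sub>R i)) differentiable (at 0)) \<and>
      continuous_on S (partial_deriv i f))"

definition C2_on :: "'a::euclidean_space set \<Rightarrow> ('a \<Rightarrow> real) \<Rightarrow> bool" where
  "C2_on S f \<longleftrightarrow> C1_on S f \<and> (\<forall>i\<in>Basis. C1_on S (partial_deriv i f))"

definition laplacian :: "('a::euclidean_space \<Rightarrow> real) \<Rightarrow> 'a \<Rightarrow> real" where
  "laplacian f x = (\<Sum>i\<in>Basis. partial_deriv i (partial_deriv i f) x)"

text \<open>Functions on the punctured space are modelled as total functions whose value
  at \<open>0\<close> is never used.\<close>

definition radial :: "('a::euclidean_space \<Rightarrow> real) \<Rightarrow> bool" where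
  "radial f \<longleftrightarrow> (\<forall>x y. x \<noteq> 0 \<longrightarrow> y \<noteq> 0 \<longrightarrow> norm x = norm y \<longrightarrow> f x = f y)"

text \<open>\<open>signed_pow s t\<close> is \<open>|t|\<^sup>s t\<close>; it is \<open>0\<close> at \<open>t = 0\<close> for every exponent \<open>s\<close>.\<close>

definition signed_pow :: "real \<Rightarrow> real \<Rightarrow> real" where
  "signed_pow s t = \<bar>t\<bar> powr s * t"

definition radial_solution ::
  "real \<Rightarrow> real \<Rightarrow> real \<Rightarrow> real \<Rightarrow> ('a::euclidean_space \<Rightarrow> real) \<Rightarrow> ('a \<Rightarrow> real) \<Rightarrow> bool" where
  "radial_solution a b p q u v \<longleftrightarrow>
     radial u \<and> radial v \<and> C2_on (- {0}) u \<and> C2_on (- {0}) v \<and>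
     (\<forall>x. x \<noteq> 0 \<longrightarrow>
        - laplacian u x = norm x powr a * signed_pow (p - 2) (v x) \<and>
        - laplacian v x = norm x powr b * signed_pow (q - 2) (u x))"

end

theory Submission
  imports Defs "HOL-Complex_Analysis.Great_Picard"
begin

text \<open>
  Put \<open>\<alpha> = (a + n) / p\<close> and \<open>\<beta> = (b + n) / q\<close>, so that \<open>\<alpha> + \<beta> = n - 2\<close> and both are nonzero.
  In the logarithmic variable \<open>t = ln |x|\<close> the ansatz
  \<open>u = |x|\<^sup>-\<^sup>\<beta> f(t)\<close>, \<open>v = \<theta> |x|\<^sup>-\<^sup>\<alpha> g(t)\<close> with \<open>\<theta> = sgn (\<alpha> \<beta>)\<close> and \<open>f, g \<ge> 0\<close>
  turns the system into the autonomous one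

  \<open>(D + \<alpha>)(D - \<beta>) f = - \<theta> g\<^sup>p\<^sup>-\<^sup>1\<close>, \<open>(D + \<beta>)(D - \<alpha>) g = - \<theta> f\<^sup>q\<^sup>-\<^sup>1\<close>,

  the two energies become multiples of the integrals of \<open>g\<^sup>p\<close> and \<open>f\<^sup>q\<close> over the line, and the four
  limits say that \<open>f\<close> and \<open>g\<close> vanish at both ends of the line. Since \<open>\<alpha> + \<beta> \<ge> 0\<close>, \<open>\<theta> = 1\<close> happens
  exactly when \<open>\<alpha>\<close> and \<open>\<beta>\<close> are both positive, and otherwise \<open>v \<le> 0\<close>; this gives the positivity
  statement.

  As neither \<open>\<alpha>\<close> nor \<open>\<beta>\<close> vanishes, \<open>- \<theta> (D + \<alpha>)(D - \<beta>)\<close> is inverted by convolution with a nonnegative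
  integrable kernel, the composition of two one-sided exponential kernels. Call the inverse \<open>T\<close>; the
  inverse for the second equation is its adjoint \<open>T'\<close>. The task is to solve \<open>h = (T' k)\<^sup>p\<^sup>-\<^sup>1\<close>,
  \<open>k = (T h)\<^sup>q\<^sup>-\<^sup>1\<close> with nontrivial \<open>h, k \<ge> 0\<close>; these are, up to scaling, the Euler-Lagrange equations for maximising
  \<open>\<integral> k T h\<close> over the unit balls of the Lebesgue spaces with exponents \<open>s = p / (p - 1)\<close> and
  \<open>\<sigma> = q / (q - 1)\<close>. The condition \<open>1 / p + 1 / q < 1\<close> says \<open>s < q\<close>, and interpolation between the
  uniform bound of \<open>T h\<close> and its norm with exponent \<open>s\<close> shows that the supremum \<open>S\<close> is finite.

  No weak compactness is used. Starting from a function \<open>h\<^sub>0\<close> whose image \<open>T h\<^sub>0\<close> has \<open>q\<close>-norm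
  at least \<open>S - \<epsilon>\<close>, let \<open>k\<close> be the norming functional of \<open>T h\<^sub>0\<close> and \<open>h\<close> that of \<open>T' k\<close>.
  These replacements do not decrease the norms (\<open>dual_profile_increases_lnorm\<close>), so
  \<open>S - \<epsilon> \<le> \<parallel>T' k\<parallel> \<le> \<parallel>T h\<parallel> \<le> S\<close>, and consequently Young's inequality for the pair
  \<open>k\<close>, \<open>T h / \<parallel>T h\<parallel>\<close> is an equality up to \<open>\<epsilon> / S\<close> after integration. The functions
  \<open>T h\<^sub>0\<close> are uniformly bounded and Lipschitz, so along a subsequence \<open>k\<close> converges pointwise; by dominated
  convergence so do \<open>T' k\<close>, \<open>h\<close> and \<open>T h\<close>. Fatou's lemma shows that the Young gap of the limit vanishes,
  and the equality case of Young's inequality is the missing equation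
  (\<open>exists_maximiser_equations\<close>). The limit is nontrivial because \<open>s < q\<close> forces \<open>sup T h\<close>
  to stay away from zero, and a translation moves a point where \<open>T h\<close> is large to the origin.
\<close>

section \<open>Exponential convolution operators\<close>

text \<open>The exponential \<open>e\<^sup>-\<^sup>l\<^sup>t\<close> on the half line where it decays: for \<open>l > 0\<close> this is \<open>t > 0\<close>, for
  \<open>l < 0\<close> it is \<open>t < 0\<close>. Thus \<open>sgn l\<close> times the kernel is the bounded fundamental solution of \<open>D + l\<close>.\<close>

definition expker :: "real \<Rightarrow> real \<Rightarrow> real" where
  "expker l t = (if l * t > 0 then exp (- (l * t)) else 0)"

text \<open>Convolution with the exponential kernel; \<open>sgn l\<close> times it is the bounded inverse of \<open>D + l\<close>.\<close>

definition expconv :: "real \<Rightarrow> (real \<Rightarrow> real) \<Rightarrow> real \<Rightarrow> real" where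
  "expconv l h t = (\<integral>s. expker l (t - s) * h s \<partial>lborel)"

text \<open>The class of functions in which the variational problem is posed: nonnegative, bounded and
  continuous functions on the line. It is preserved by all operations used in the argument.\<close>

definition profile :: "(real \<Rightarrow> real) \<Rightarrow> bool" where
  "profile h \<longleftrightarrow> continuous_on UNIV h \<and> (\<forall>t. 0 \<le> h t) \<and> (\<exists>C. \<forall>t. h t \<le> C)"

lemma profileI: "continuous_on UNIV h \<Longrightarrow> (\<And>t. 0 \<le> h t) \<Longrightarrow> (\<And>t. h t \<le> C) \<Longrightarrow> profile h"
  by (auto simp: profile_def)

lemma profile_nonneg: "profile h \<Longrightarrow> 0 \<le> h t"
  by (auto simp: profile_def)

lemma profile_continuous: "profile h \<Longrightarrow> continuous_on S h"
  by (auto simp: profile_def intro: continuous_on_subset)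

lemma profile_bound:
  assumes "profile h" obtains C where "C > 0" "\<And>t. h t \<le> C"
proof -
  obtain C where C: "\<And>t. h t \<le> C" using assms by (auto simp: profile_def)
  show ?thesis
    by (rule that[of "max C 1"]) (auto intro: order_trans[OF C])
qed

lemma profile_measurable [measurable_dest]: "profile h \<Longrightarrow> h \<in> borel_measurable borel"
  by (rule borel_measurable_continuous_onI) (auto simp: profile_def)

lemma profile_powr:
  assumes "profile h" "r > 0" shows "profile (\<lambda>t. h t powr r)"
proof -
  obtain C where C: "C > 0" "\<And>t. h t \<le> C" using profile_bound[OF assms(1)] by blast
  show ?thesis
  proof (rule profileI)
    show "continuous_on UNIV (\<lambda>t. h t powr r)"
      using assms by (intro continuous_on_powr') (auto simp: profile_continuous profile_nonneg)
    show "h t powr r \<le> C powr r" for t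
      using assms C by (intro powr_mono2) (auto simp: profile_nonneg)
  qed simp
qed

lemma profile_cmult: "profile h \<Longrightarrow> 0 \<le> c \<Longrightarrow> profile (\<lambda>t. c * h t)"
  by (rule profile_bound[of h], assumption)
     (rule_tac C="c * C" in profileI,
       auto intro!: continuous_intros mult_left_mono simp: profile_continuous profile_nonneg)

lemma profile_divide: "profile h \<Longrightarrow> 0 \<le> c \<Longrightarrow> profile (\<lambda>t. h t / c)"
  using profile_cmult[of h "1 / c"] by simp

lemma profile_comp:
  assumes "profile h" "continuous_on UNIV g" shows "profile (\<lambda>t. h (g t))"
proof -
  obtain C where C: "C > 0" "\<And>t. h t \<le> C" using profile_bound[OF assms(1)] by blast
  show ?thesis
    by (rule profileI[of _ C])
       (auto intro: continuous_on_compose2[OF profile_continuous[OF assms(1)] assms(2)]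
         simp: C profile_nonneg[OF assms(1)])
qed

lemma expker_nonneg [simp]: "0 \<le> expker l t"
  by (simp add: expker_def)

lemma expker_le_one: "expker l t \<le> 1"
  by (simp add: expker_def)

lemma expker_measurable [measurable]: "expker l \<in> borel_measurable borel"
  unfolding expker_def[abs_def] by measurable

lemma expker_minus: "expker (- l) t = expker l (- t)"
  by (simp add: expker_def)

lemma expker_powr: "r > 0 \<Longrightarrow> expker l t powr r = expker (r * l) t"
  using zero_less_mult_iff[of r "l * t"] by (simp add: expker_def powr_def mult.assoc)

lemma nn_integral_expker_pos:
  assumes "l > 0" shows "(\<integral>\<^sup>+t. ennreal (expker l t) \<partial>lborel) = ennreal (1 / l)"
proof -
  have "(\<integral>\<^sup>+t. ennreal (expker l t) \<partial>lborel)
      = (\<integral>\<^sup>+t. ennreal (exp (- (l * t))) * indicator {0..} t \<partial>lborel)"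
    by (rule nn_integral_cong_AE, rule AE_mp[OF AE_lborel_singleton[of 0]])
       (use assms in \<open>auto simp: expker_def zero_less_mult_iff indicator_def intro!: AE_I2\<close>)
  also have "\<dots> = ennreal (0 - (- exp (- (l * 0)) / l))"
  proof (rule nn_integral_FTC_atLeast)
    show "((\<lambda>t. - exp (- (l * t)) / l) \<longlongrightarrow> 0) at_top"
      using assms by real_asymp
    show "((\<lambda>t. - exp (- (l * t)) / l) has_real_derivative exp (- (l * x))) (at x)"
      if "0 \<le> x" for x
      using assms by (auto intro!: derivative_eq_intros)
  qed (use assms in auto)
  finally show ?thesis by simp
qed

lemma nn_integral_real_reflect:
  fixes f :: "real \<Rightarrow> ennreal"
  assumes [measurable]: "f \<in> borel_measurable borel"
  shows "(\<integral>\<^sup>+s. f (t - s) \<partial>lborel) = (\<integral>\<^sup>+s. f s \<partial>lborel)"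
  using nn_integral_real_affine[of f "-1" t] by simp

lemma nn_integral_expker:
  assumes "l \<noteq> 0" shows "(\<integral>\<^sup>+t. ennreal (expker l t) \<partial>lborel) = ennreal (1 / \<bar>l\<bar>)"
proof (cases "l > 0")
  case True then show ?thesis using nn_integral_expker_pos[of l] by simp
next
  case False
  then have *: "- l > 0" using assms by simp
  have "(\<integral>\<^sup>+t. ennreal (expker l t) \<partial>lborel) = (\<integral>\<^sup>+t. ennreal (expker l (0 - t)) \<partial>lborel)"
    by (rule nn_integral_real_reflect[symmetric]) measurable
  also have "\<dots> = (\<integral>\<^sup>+t. ennreal (expker (- l) t) \<partial>lborel)"
    by (simp add: expker_minus)
  also have "\<dots> = ennreal (1 / (- l))" by (rule nn_integral_expker_pos[OF *])
  finally show ?thesis using False by simp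
qed

lemma
  assumes "l \<noteq> 0"
  shows integrable_expker: "integrable lborel (expker l)"
    and integral_expker: "(\<integral>t. expker l t \<partial>lborel) = 1 / \<bar>l\<bar>"
  using nn_integral_expker[OF assms]
  by (auto intro!: integrableI_nn_integral_finite simp: integral_eq_nn_integral)

lemma
  fixes f :: "real \<Rightarrow> real"
  assumes "integrable lborel f"
  shows integrable_reflect: "integrable lborel (\<lambda>s. f (t - s))"
    and integral_reflect: "(\<integral>s. f (t - s) \<partial>lborel) = (\<integral>s. f s \<partial>lborel)"
  using lborel_integrable_real_affine[OF assms, of "-1" t] lborel_integral_real_affine[of "-1" f t]
  by auto

lemma integrable_expconv:
  assumes "l \<noteq> 0" and [measurable]: "h \<in> borel_measurable borel" and "\<And>s. \<bar>h s\<bar> \<le> C"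
  shows "integrable lborel (\<lambda>s. expker l (t - s) * h s)"
proof (rule Bochner_Integration.integrable_bound)
  show "integrable lborel (\<lambda>s. C * expker l (t - s))"
    using integrable_reflect[OF integrable_expker[OF assms(1)]] by auto
  show "AE s in lborel. norm (expker l (t - s) * h s) \<le> norm (C * expker l (t - s))"
  proof (rule AE_I2)
    fix s
    have "\<bar>h s\<bar> * expker l (t - s) \<le> \<bar>C\<bar> * expker l (t - s)"
      by (rule mult_right_mono) (use assms(3)[of s] in auto)
    then show "norm (expker l (t - s) * h s) \<le> norm (C * expker l (t - s))"
      by (simp add: abs_mult mult.commute)
  qed
qed measurable

lemma integrable_expconv_profile:
  assumes "l \<noteq> 0" "profile h"
  shows "integrable lborel (\<lambda>s. expker l (t - s) * h s)"
proof -
  obtain C where "\<And>t. h t \<le> C" using profile_bound[OF assms(2)] by blast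
  then show ?thesis
    using assms by (intro integrable_expconv[of l h C]) (auto simp: profile_nonneg profile_measurable)
qed

lemma expconv_const: "l \<noteq> 0 \<Longrightarrow> expconv l (\<lambda>_. c) t = c / \<bar>l\<bar>"
  using integral_reflect[OF integrable_expker[of l], of t] integral_expker[of l]
  by (simp add: expconv_def)

lemma expconv_cmult: "expconv l (\<lambda>s. c * h s) t = c * expconv l h t"
  by (simp add: expconv_def mult.left_commute)

lemma expconv_nonneg: "(\<And>s. 0 \<le> h s) \<Longrightarrow> 0 \<le> expconv l h t"
  unfolding expconv_def by (rule Bochner_Integration.integral_nonneg) auto

lemma expconv_le:
  assumes "l \<noteq> 0" "profile h" "\<And>s. h s \<le> C"
  shows "expconv l h t \<le> C / \<bar>l\<bar>"
proof -
  have "expconv l h t \<le> expconv l (\<lambda>_. C) t"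
    unfolding expconv_def
    by (rule integral_mono)
       (auto intro!: mult_left_mono integrable_expconv_profile assms
          integrable_reflect[OF integrable_expker[OF assms(1)]])
  then show ?thesis using assms by (simp add: expconv_const)
qed

lemma expconv_shift:
  "expconv l (\<lambda>s. h (s + c)) t = expconv l h (t + c)"
  unfolding expconv_def
  using lborel_integral_real_affine[of 1 "\<lambda>s. expker l (t + c - s) * h s" c]
  by (simp add: algebra_simps)

lemma expconv_reflect:
  "expconv (- l) (\<lambda>s. h (- s)) (- t) = expconv l h t"
  unfolding expconv_def
  using lborel_integral_real_affine[of "-1" "\<lambda>s. expker l (t - s) * h s" 0]
  by (simp add: expker_minus add.commute)

text \<open>The variation-of-constants formula, from which differentiability follows.\<close>

lemma expconv_split:
  assumes "l > 0" "profile h" "a \<le> t"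
  shows "expconv l h t = exp (- l * (t - a)) * expconv l h a
      + exp (- l * t) * integral {a..t} (\<lambda>s. exp (l * s) * h s)"
proof -
  have int: "set_integrable lborel {a..t} (\<lambda>s. exp (l * s) * h s)"
    by (rule borel_integrable_atLeastAtMost') (auto intro!: continuous_intros profile_continuous[OF assms(2)])
  have "expconv l h t = (\<integral>s. exp (- l * (t - a)) * (expker l (a - s) * h s)
      + exp (- l * t) * (indicator {a..t} s *\<^sub>R (exp (l * s) * h s)) \<partial>lborel)"
    unfolding expconv_def
  proof (rule integral_cong_AE)
    show "AE s in lborel. expker l (t - s) * h s = exp (- l * (t - a)) * (expker l (a - s) * h s)
      + exp (- l * t) * (indicator {a..t} s *\<^sub>R (exp (l * s) * h s))"
      using AE_lborel_singleton[of a] AE_lborel_singleton[of t]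
    proof eventually_elim
      case (elim s)
      consider "s < a" | "a < s" "s < t" | "t < s" using elim by force
      then show ?case
        by cases (use assms in \<open>auto simp: expker_def zero_less_mult_iff right_diff_distrib
          mult.assoc[symmetric] exp_add[symmetric]\<close>)
    qed
  qed (use assms(2) in measurable)
  also have "\<dots> = exp (- l * (t - a)) * expconv l h a
      + exp (- l * t) * (\<integral>s. indicator {a..t} s *\<^sub>R (exp (l * s) * h s) \<partial>lborel)"
    unfolding expconv_def
    by (subst Bochner_Integration.integral_add)
       (use int integrable_expconv_profile[OF _ assms(2), of l a] assms(1) in
         \<open>auto simp: set_integrable_def intro!: integrable_mult_right\<close>)
  also have "(\<integral>s. indicator {a..t} s *\<^sub>R (exp (l * s) * h s) \<partial>lborel)
      = integral {a..t} (\<lambda>s. exp (l * s) * h s)"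
    using set_borel_integral_eq_integral(2)[OF int] by (simp add: set_lebesgue_integral_def)
  finally show ?thesis .
qed

lemma expconv_deriv_pos:
  assumes "l > 0" "profile h"
  shows "(expconv l h has_real_derivative (h t - l * expconv l h t)) (at t)"
proof -
  define a where "a = t - 1"
  define I where "I t = integral {a..t} (\<lambda>s. exp (l * s) * h s)" for t
  have "(I has_real_derivative exp (l * t) * h t) (at t within {a..t+1})"
    unfolding I_def
    by (rule integral_has_real_derivative)
      (auto intro!: continuous_intros profile_continuous[OF assms(2)] simp: a_def)
  moreover have "at t within {a..t+1} = at t"
    by (rule at_within_interior) (simp add: a_def)
  ultimately have I: "(I has_real_derivative exp (l * t) * h t) (at t)" by simp
  have 1: "expconv l h t = exp (- l * (t - a)) * expconv l h a + exp (- l * t) * I t"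
    using expconv_split[OF assms, of a t] by (simp add: I_def a_def)
  have "((\<lambda>t. exp (- l * (t - a)) * expconv l h a + exp (- l * t) * I t)
     has_real_derivative (h t - l * expconv l h t)) (at t)"
    by (rule derivative_eq_intros I refl | simp)+
       (simp add: 1 algebra_simps exp_minus)
  moreover have "\<forall>\<^sub>F x in nhds t.
      exp (- l * (x - a)) * expconv l h a + exp (- l * x) * I x = expconv l h x"
  proof -
    have "\<forall>\<^sub>F x in nhds t. x \<in> {a<..}"
      by (rule eventually_nhds_in_open) (auto simp: a_def)
    then show ?thesis
    proof eventually_elim
      case (elim x)
      then have "a \<le> x" by simp
      from expconv_split[OF assms this] show ?case by (metis I_def)
    qed
  qed
  ultimately show ?thesis
    using DERIV_cong_ev[OF refl _ refl] by fast
qed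

lemma expconv_deriv:
  assumes "l \<noteq> 0" "profile h"
  shows "(expconv l h has_real_derivative (sgn l * h t - l * expconv l h t)) (at t)"
proof (cases "l > 0")
  case True then show ?thesis using expconv_deriv_pos[OF True assms(2)] by simp
next
  case False
  then have l: "- l > 0" using assms by simp
  define k where "k = (\<lambda>s. h (- s))"
  have k: "profile k" unfolding k_def by (rule profile_comp[OF assms(2)]) (auto intro: continuous_intros)
  have eq: "expconv l h = (\<lambda>t. expconv (- l) k (- t))"
    by (rule ext) (simp add: expconv_reflect k_def)
  have "((\<lambda>t. expconv (- l) k (- t)) has_real_derivative
      (k (- t) - (- l) * expconv (- l) k (- t)) * (- 1)) (at t)"
    by (rule DERIV_chain2[OF expconv_deriv_pos[OF l k]]) (auto intro!: derivative_eq_intros)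
  then show ?thesis
    using False assms by (simp add: eq k_def)
qed

lemma profile_expconv:
  assumes "l \<noteq> 0" "profile h" shows "profile (expconv l h)"
proof -
  obtain C where "\<And>t. h t \<le> C" using profile_bound[OF assms(2)] by blast
  show ?thesis
  proof (rule profileI)
    show "continuous_on UNIV (expconv l h)"
      using expconv_deriv[OF assms] by (meson DERIV_isCont continuous_at_imp_continuous_on)
    show "expconv l h t \<le> C / \<bar>l\<bar>" for t by (rule expconv_le) fact+
  qed (auto intro: expconv_nonneg profile_nonneg assms)
qed

lemma nn_integral_expconv:
  assumes "l \<noteq> 0" "profile h"
  shows "ennreal (expconv l h t) = (\<integral>\<^sup>+s. ennreal (expker l (t - s) * h s) \<partial>lborel)"
  unfolding expconv_def
  by (rule nn_integral_eq_integral[symmetric])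
     (use assms in \<open>auto intro!: AE_I2 integrable_expconv_profile simp: profile_nonneg\<close>)

text \<open>The adjoint of convolution with parameter \<open>l\<close> is convolution with parameter \<open>-l\<close>.\<close>

lemma nn_integral_expconv_adjoint:
  assumes "l \<noteq> 0" and h: "profile h" and k: "profile k"
  shows "(\<integral>\<^sup>+t. ennreal (k t * expconv l h t) \<partial>lborel) = (\<integral>\<^sup>+t. ennreal (expconv (- l) k t * h t) \<partial>lborel)"
proof -
  note [measurable] = profile_measurable[OF h] profile_measurable[OF k]
  note nn = profile_nonneg[OF h] profile_nonneg[OF k]
  have "(\<integral>\<^sup>+t. ennreal (k t * expconv l h t) \<partial>lborel)
      = (\<integral>\<^sup>+t. (\<integral>\<^sup>+s. ennreal (k t * (expker l (t - s) * h s)) \<partial>lborel) \<partial>lborel)"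
    by (intro nn_integral_cong) (simp add: nn ennreal_mult' nn_integral_expconv[OF assms(1) h] nn_integral_cmult)
  also have "\<dots> = (\<integral>\<^sup>+s. (\<integral>\<^sup>+t. ennreal (k t * (expker l (t - s) * h s)) \<partial>lborel) \<partial>lborel)"
    by (rule lborel_pair.Fubini') measurable
  also have "\<dots> = (\<integral>\<^sup>+s. (\<integral>\<^sup>+t. ennreal (h s) * ennreal (expker (- l) (s - t) * k t) \<partial>lborel) \<partial>lborel)"
    by (intro nn_integral_cong) (simp add: nn expker_minus mult_ac flip: ennreal_mult')
  also have "\<dots> = (\<integral>\<^sup>+s. ennreal (expconv (- l) k s * h s) \<partial>lborel)"
  proof (intro nn_integral_cong)
    fix s
    have "(\<integral>\<^sup>+t. ennreal (h s) * ennreal (expker (- l) (s - t) * k t) \<partial>lborel)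
        = ennreal (h s) * ennreal (expconv (- l) k s)"
      using assms(1) k by (simp add: nn_integral_cmult nn_integral_expconv)
    then show "(\<integral>\<^sup>+t. ennreal (h s) * ennreal (expker (- l) (s - t) * k t) \<partial>lborel)
        = ennreal (expconv (- l) k s * h s)"
      by (simp add: nn expconv_nonneg ennreal_mult mult.commute)
  qed
  finally show ?thesis .
qed

lemma integral_expconv_adjoint:
  assumes "l \<noteq> 0" and h: "profile h" and k: "profile k"
  shows "(\<integral>t. k t * expconv l h t \<partial>lborel) = (\<integral>t. expconv (- l) k t * h t \<partial>lborel)"
proof -
  have l: "- l \<noteq> 0" using assms by simp
  note [measurable] = profile_measurable[OF h] profile_measurable[OF k]
     profile_measurable[OF profile_expconv[OF assms(1) h]] profile_measurable[OF profile_expconv[OF l k]]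
  show ?thesis
    by (subst (1 2) integral_eq_nn_integral)
      (auto simp: nn_integral_expconv_adjoint[OF assms] intro!: AE_I2 mult_nonneg_nonneg
         profile_nonneg[OF h] profile_nonneg[OF k] profile_nonneg[OF profile_expconv[OF assms(1) h]]
         profile_nonneg[OF profile_expconv[OF l k]])
qed

lemma
  assumes "l \<noteq> 0" and h: "profile h" and int: "integrable lborel h"
  shows integrable_expconv_integrable: "integrable lborel (expconv l h)"
    and integral_expconv_eq: "(\<integral>t. expconv l h t \<partial>lborel) = (\<integral>t. h t \<partial>lborel) / \<bar>l\<bar>"
proof -
  have l: "- l \<noteq> 0" using assms by simp
  have one: "profile (\<lambda>_. 1)" by (rule profileI[of _ 1]) auto
  note [measurable] = profile_measurable[OF h] profile_measurable[OF profile_expconv[OF assms(1) h]]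
  have "(\<integral>\<^sup>+t. ennreal (expconv l h t) \<partial>lborel) = (\<integral>\<^sup>+t. ennreal (h t / \<bar>l\<bar>) \<partial>lborel)"
    using nn_integral_expconv_adjoint[OF assms(1) h one] l by (simp add: expconv_const)
  also have "\<dots> = ennreal (\<integral>t. h t / \<bar>l\<bar> \<partial>lborel)"
    using int by (intro nn_integral_eq_integral) (auto simp: profile_nonneg[OF h])
  finally show "integrable lborel (expconv l h)"
    by (rule integrableI_nn_integral_finite[rotated 2])
       (auto intro!: expconv_nonneg profile_nonneg[OF h])
  show "(\<integral>t. expconv l h t \<partial>lborel) = (\<integral>t. h t \<partial>lborel) / \<bar>l\<bar>"
    using integral_expconv_adjoint[OF assms(1) h one] l by (simp add: expconv_const)
qed


section \<open>Integrability and decay of exponential convolutions\<close>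

lemma conjugate_exponents:
  fixes s r :: real
  assumes "s > 1" "1 / s + 1 / r = 1"
  shows "r > 1" "(r - 1) * s = r" "(s - 1) * r = s" "(r - 1) * (s - 1) = 1"
proof -
  have "r \<noteq> 0" using assms by auto
  then have "r + s = s * r" using assms by (simp add: field_simps)
  then have rs: "r * (s - 1) = s" by (simp add: algebra_simps)
  then have r: "r = s / (s - 1)" using assms(1) by (simp add: field_simps)
  show "r > 1" unfolding r using assms(1) by (simp add: field_simps)
  show "(r - 1) * s = r" "(s - 1) * r = s" "(r - 1) * (s - 1) = 1"
    using rs by (auto simp: algebra_simps)
qed

text \<open>The equality case of Young's inequality, in contrapositive form: the gap is a strictly convex
  function of \<open>x\<close> which vanishes at \<open>y powr (r - 1)\<close>.\<close>

lemma Young_strict: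
  fixes x y s r :: real
  assumes "s > 1" "1 / s + 1 / r = 1" "0 \<le> x" "0 \<le> y" "x \<noteq> y powr (r - 1)"
  shows "x * y < x powr s / s + y powr r / r"
proof -
  note rs = conjugate_exponents[OF assms(1,2)]
  define z where "z = y powr (r - 1)"
  define D where "D w = w powr s / s + y powr r / r - w * y" for w
  have y: "y powr (r - 1) * y = y powr r"
    using powr_add[of y "r - 1" 1] assms(4) by (cases "y = 0") auto
  have Dz: "D z = 0"
  proof -
    have "y powr r * (1 / s + 1 / r) = y powr r" using assms(2) by simp
    then show ?thesis
      by (simp add: D_def z_def powr_powr rs y distrib_left)
  qed
  have z0: "0 \<le> z" by (simp add: z_def)
  have zpow: "z powr (s - 1) = y"
    using assms(4) by (simp add: z_def powr_powr rs)
  have deriv: "(D has_real_derivative (w powr (s - 1) - y)) (at w)" if "w > 0" for w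
    unfolding D_def using that assms(1)
    by (auto intro!: derivative_eq_intros simp: field_simps)
  have mvt: "\<exists>w>u. w < v \<and> D v - D u = (v - u) * (w powr (s - 1) - y)" if uv: "0 \<le> u" "u < v" for u v
  proof -
    have "continuous_on {u..v} D"
      unfolding D_def using uv assms(1) by (intro continuous_intros continuous_on_powr') auto
    moreover have "D differentiable (at w)" if "u < w" "w < v" for w
      using deriv[of w] uv that by (auto simp: real_differentiable_def)
    ultimately obtain l w where w: "u < w" "w < v" "(D has_real_derivative l) (at w)" "D v - D u = (v - u) * l"
      using MVT[OF uv(2)] by blast
    then have "l = w powr (s - 1) - y"
      using DERIV_unique[OF w(3) deriv] uv by simp
    then show ?thesis using w by auto
  qed
  have "D x > 0"
  proof (cases "x < z")
    case True
    obtain w where w: "x < w" "w < z" "D z - D x = (z - x) * (w powr (s - 1) - y)"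
      using mvt[OF assms(3) True] by blast
    have "w powr (s - 1) < y"
      unfolding zpow[symmetric] using w assms by (intro powr_less_mono2) auto
    then have "(z - x) * (w powr (s - 1) - y) < 0"
      using True by (intro mult_pos_neg) auto
    then show ?thesis using w Dz by simp
  next
    case False
    then have *: "z < x" using assms(5) by (simp add: z_def)
    obtain w where w: "z < w" "w < x" "D x - D z = (x - z) * (w powr (s - 1) - y)"
      using mvt[OF z0 *] by blast
    have "y < w powr (s - 1)"
      unfolding zpow[symmetric] using w assms z0 by (intro powr_less_mono2) auto
    then have "(x - z) * (w powr (s - 1) - y) > 0"
      using * by (intro mult_pos_pos) auto
    then show ?thesis using w Dz by simp
  qed
  then show ?thesis by (simp add: D_def)
qed

lemma Young_weak:
  fixes x y s r :: real
  assumes "s > 1" "1 / s + 1 / r = 1" "0 \<le> x" "0 \<le> y"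
  shows "x * y \<le> x powr s / s + y powr r / r"
  using Youngs_inequality[of s r x y] conjugate_exponents[OF assms(1,2)] assms by simp

lemma expconv_mono:
  assumes "l \<noteq> 0" "profile h" "profile k" "\<And>t. h t \<le> k t"
  shows "expconv l h t \<le> expconv l k t"
  unfolding expconv_def
  by (rule integral_mono) (auto intro!: mult_left_mono integrable_expconv_profile assms)

text \<open>Jensen's inequality for the probability density \<open>\<bar>l\<bar> expker l\<close>, obtained by integrating the
  tangent line of \<open>x powr s\<close> at the mean value \<open>m\<close>.\<close>

lemma expconv_powr_le:
  assumes "l \<noteq> 0" "profile h" "s > 1"
  shows "(\<bar>l\<bar> * expconv l h t) powr s \<le> \<bar>l\<bar> * expconv l (\<lambda>u. h u powr s) t"
proof -
  define m where "m = \<bar>l\<bar> * expconv l h t"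
  define r where "r = s / (s - 1)"
  have sr: "1 / s + 1 / r = 1" using assms(3) by (simp add: r_def field_simps)
  note rs = conjugate_exponents[OF assms(3) sr]
  have m0: "0 \<le> m" by (simp add: m_def expconv_nonneg profile_nonneg[OF assms(2)])
  have sm: "m powr (s - 1) * m = m powr s"
    using powr_add[of m "s - 1" 1] m0 by (cases "m = 0") auto
  note hs = profile_powr[OF assms(2), of s]
  have tangent: "s * m powr (s - 1) * x \<le> x powr s + (s - 1) * m powr s" if "0 \<le> x" for x
  proof -
    have "x * m powr (s - 1) \<le> x powr s / s + (m powr (s - 1)) powr r / r"
      by (rule Young_weak) (use assms(3) sr that in auto)
    also have "(m powr (s - 1)) powr r / r = m powr s * ((s - 1) / s)"
      unfolding powr_powr rs(3) using assms(3) by (simp add: r_def)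
    finally have "s * (x * m powr (s - 1)) \<le> s * (x powr s / s + m powr s * ((s - 1) / s))"
      using assms(3) by (intro mult_left_mono) auto
    also have "\<dots> = x powr s + (s - 1) * m powr s"
      using assms(3) by (simp add: distrib_left)
    finally show ?thesis by (simp add: mult_ac)
  qed
  have "s * m powr (s - 1) * expconv l h t \<le> expconv l (\<lambda>u. h u powr s) t + (s - 1) * m powr s / \<bar>l\<bar>"
  proof -
    have "expconv l (\<lambda>u. s * m powr (s - 1) * h u) t \<le> expconv l (\<lambda>u. h u powr s + (s - 1) * m powr s) t"
    proof (rule expconv_mono)
      obtain C where C: "\<And>t. h t powr s \<le> C" using profile_bound[OF hs] assms(3) by auto
      show "profile (\<lambda>u. h u powr s + (s - 1) * m powr s)"
        by (rule profileI[of _ "C + (s - 1) * m powr s"])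
          (use assms(3) C in \<open>auto intro!: continuous_intros profile_continuous[OF hs]\<close>)
      show "profile (\<lambda>u. s * m powr (s - 1) * h u)"
        by (rule profile_cmult) (use assms in auto)
    qed (use assms tangent profile_nonneg in auto)
    also have "\<dots> = expconv l (\<lambda>u. h u powr s) t + expconv l (\<lambda>u. (s - 1) * m powr s) t"
      unfolding expconv_def distrib_left
      by (rule Bochner_Integration.integral_add)
         (use assms hs integrable_reflect[OF integrable_expker[OF assms(1)], of t] in
           \<open>auto intro!: integrable_expconv_profile\<close>)
    finally show ?thesis
      using assms(1) by (simp add: expconv_cmult expconv_const)
  qed
  then have "\<bar>l\<bar> * (s * m powr (s - 1) * expconv l h t) \<le> \<bar>l\<bar> * (expconv l (\<lambda>u. h u powr s) t + (s - 1) * m powr s / \<bar>l\<bar>)"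
    by (rule mult_left_mono) simp
  also have "\<bar>l\<bar> * (s * m powr (s - 1) * expconv l h t) = s * m powr s"
    unfolding sm[symmetric] by (simp add: m_def)
  also have "\<bar>l\<bar> * (expconv l (\<lambda>u. h u powr s) t + (s - 1) * m powr s / \<bar>l\<bar>)
      = \<bar>l\<bar> * expconv l (\<lambda>u. h u powr s) t + s * m powr s - m powr s"
    using assms(1) by (simp add: distrib_left left_diff_distrib)
  finally show ?thesis by (simp add: m_def)
qed

lemma
  assumes "l \<noteq> 0" "profile h" "s > 1" "integrable lborel (\<lambda>t. h t powr s)"
  shows integrable_expconv_powr: "integrable lborel (\<lambda>t. expconv l h t powr s)"
    and integral_expconv_powr_le:
      "\<bar>l\<bar> powr s * (\<integral>t. expconv l h t powr s \<partial>lborel) \<le> (\<integral>t. h t powr s \<partial>lborel)"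
proof -
  have hs: "profile (\<lambda>t. h t powr s)" using profile_powr[OF assms(2)] assms(3) by simp
  note [measurable] = profile_measurable[OF profile_expconv[OF assms(1,2)]]
  have le: "\<bar>l\<bar> powr s * expconv l h t powr s \<le> \<bar>l\<bar> * expconv l (\<lambda>u. h u powr s) t" for t
    using expconv_powr_le[OF assms(1-3), of t]
    by (simp add: powr_mult expconv_nonneg profile_nonneg[OF assms(2)])
  have int: "integrable lborel (\<lambda>t. \<bar>l\<bar> * expconv l (\<lambda>u. h u powr s) t)"
    using integrable_expconv_integrable[OF assms(1) hs assms(4)] by simp
  have *: "integrable lborel (\<lambda>t. \<bar>l\<bar> powr s * expconv l h t powr s)"
    by (rule Bochner_Integration.integrable_bound[OF int])
       (auto intro!: AE_I2 order_trans[OF le] simp: abs_of_nonneg expconv_nonneg)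
  then show "integrable lborel (\<lambda>t. expconv l h t powr s)"
    using assms(1) by simp
  have "(\<integral>t. \<bar>l\<bar> powr s * expconv l h t powr s \<partial>lborel) \<le> (\<integral>t. \<bar>l\<bar> * expconv l (\<lambda>u. h u powr s) t \<partial>lborel)"
    by (rule integral_mono[OF * int le])
  also have "\<dots> = (\<integral>t. h t powr s \<partial>lborel)"
    using integral_expconv_eq[OF assms(1) hs assms(4)] assms(1) by simp
  finally show "\<bar>l\<bar> powr s * (\<integral>t. expconv l h t powr s \<partial>lborel) \<le> (\<integral>t. h t powr s \<partial>lborel)"
    by simp
qed

text \<open>Profiles in the unit ball of the Lebesgue space with exponent \<open>s\<close>.\<close>

definition unit_profile :: "real \<Rightarrow> (real \<Rightarrow> real) \<Rightarrow> bool" where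
  "unit_profile s h \<longleftrightarrow> profile h \<and> integrable lborel (\<lambda>t. h t powr s) \<and> (\<integral>t. h t powr s \<partial>lborel) \<le> 1"

text \<open>A bound uniform over the unit ball; pointwise application of Young's inequality under the
  integral replaces that of Hoelder.\<close>

lemma expconv_unit_profile_le:
  assumes "l \<noteq> 0" "s > 1" "unit_profile s h"
  shows "expconv l h t \<le> 1 + 1 / \<bar>l\<bar>"
proof -
  define r where "r = s / (s - 1)"
  have sr: "1 / s + 1 / r = 1" using assms(2) by (simp add: r_def field_simps)
  note rs = conjugate_exponents[OF assms(2) sr]
  have h: "profile h" "integrable lborel (\<lambda>t. h t powr s)" "(\<integral>t. h t powr s \<partial>lborel) \<le> 1"
    using assms(3) by (auto simp: unit_profile_def)
  have rl: "r * l \<noteq> 0" using assms(1) rs by auto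
  note E = integrable_reflect[OF integrable_expker[OF rl], of t] 
  have "expconv l h t \<le> (\<integral>u. h u powr s / s + expker (r * l) (t - u) / r \<partial>lborel)"
    unfolding expconv_def
  proof (rule integral_mono)
    show "expker l (t - u) * h u \<le> h u powr s / s + expker (r * l) (t - u) / r" for u
      using Young_weak[OF assms(2) sr, of "h u" "expker l (t - u)"] rs(1)
      by (simp add: profile_nonneg[OF h(1)] expker_powr mult.commute)
  qed (use h E assms in \<open>auto intro!: integrable_expconv_profile\<close>)
  also have "\<dots> = (\<integral>u. h u powr s \<partial>lborel) / s + 1 / (r * r * \<bar>l\<bar>)"
    using h(2) E integral_reflect[OF integrable_expker[OF rl], of t] rs(1)
    by (simp add: integral_expker[OF rl] abs_mult)
  also have "\<dots> \<le> 1 + 1 / \<bar>l\<bar>"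
  proof (rule add_mono)
    have "(\<integral>u. h u powr s \<partial>lborel) / s \<le> 1 / s"
      using h assms(2) by (intro divide_right_mono) auto
    also have "\<dots> \<le> 1" using assms(2) by simp
    finally show "(\<integral>u. h u powr s \<partial>lborel) / s \<le> 1" .
    have "1 * 1 \<le> r * r" using rs by (intro mult_mono) auto
    then have "1 * \<bar>l\<bar> \<le> r * r * \<bar>l\<bar>" by (intro mult_right_mono) auto
    then show "1 / (r * r * \<bar>l\<bar>) \<le> 1 / \<bar>l\<bar>"
      using assms(1) by (intro divide_left_mono) (auto intro!: mult_pos_pos simp: rs)
  qed
  finally show ?thesis .
qed

lemma expconv_tendsto:
  assumes "l \<noteq> 0" "\<And>j. h j \<in> borel_measurable borel" "k \<in> borel_measurable borel"
    and "\<And>j t. \<bar>h j t\<bar> \<le> C" "\<And>t. (\<lambda>j. h j t) \<longlonglongrightarrow> k t"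
  shows "(\<lambda>j. expconv l (h j) t) \<longlonglongrightarrow> expconv l k t"
  unfolding expconv_def
proof (rule integral_dominated_convergence)
  note [measurable] = assms(2,3)
  show "(\<lambda>s. expker l (t - s) * k s) \<in> borel_measurable lborel" by measurable
  show "(\<lambda>s. expker l (t - s) * h j s) \<in> borel_measurable lborel" for j by measurable
  show "integrable lborel (\<lambda>s. C * expker l (t - s))"
    using integrable_reflect[OF integrable_expker[OF assms(1)]] by auto
  show "AE s in lborel. (\<lambda>j. expker l (t - s) * h j s) \<longlonglongrightarrow> expker l (t - s) * k s"
    by (intro AE_I2 tendsto_intros assms)
  show "AE s in lborel. norm (expker l (t - s) * h j s) \<le> C * expker l (t - s)" for j
    by (intro AE_I2) (simp add: abs_mult mult.commute[of "expker l _"] mult_right_mono assms(4))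
qed

lemma expker_tendsto_0:
  assumes "l \<noteq> 0" "filterlim X at_top F \<or> filterlim X at_bot F"
  shows "((\<lambda>x. expker l (X x - s)) \<longlongrightarrow> 0) F"
proof -
  have *: "((\<lambda>x. expker l (x - s)) \<longlongrightarrow> 0) at_top" if "l \<noteq> 0" for l s
  proof (cases "l > 0")
    case True
    have "((\<lambda>x. exp (- (l * (x - s)))) \<longlongrightarrow> 0) at_top" using True by real_asymp
    then show ?thesis
      by (rule tendsto_sandwich[OF _ _ tendsto_const, rotated 2]) (auto simp: expker_def)
  next
    case False
    then have "l < 0" using that by simp
    have "\<forall>\<^sub>F x in at_top. expker l (x - s) = 0"
      using eventually_gt_at_top[of s]
      by eventually_elim (use \<open>l < 0\<close> in \<open>auto simp: expker_def zero_less_mult_iff\<close>)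
    then show ?thesis by (rule tendsto_eventually)
  qed
  have "((\<lambda>x. expker l (x - s)) \<longlongrightarrow> 0) at_bot"
  proof -
    have "((\<lambda>x. expker (- l) (x - (- s))) \<longlongrightarrow> 0) at_top" using *[of "- l" "- s"] assms by simp
    then show ?thesis
      by (simp add: filterlim_at_bot_mirror expker_minus algebra_simps)
  qed
  with *[OF assms(1), of s] show ?thesis
    using assms(2) filterlim_compose by blast
qed

lemma expconv_tendsto_0:
  assumes "l \<noteq> 0" "profile h" "s > 1" "integrable lborel (\<lambda>t. h t powr s)"
    and X: "filterlim X at_top sequentially \<or> filterlim X at_bot sequentially"
  shows "(\<lambda>j. expconv l h (X j)) \<longlonglongrightarrow> 0"
proof -
  have hs: "profile (\<lambda>t. h t powr s)" using profile_powr[OF assms(2)] assms(3) by simp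
  note [measurable] = profile_measurable[OF hs]
  have "(\<lambda>j. expconv l (\<lambda>u. h u powr s) (X j)) \<longlonglongrightarrow> (\<integral>u. 0 \<partial>(lborel :: real measure))"
    unfolding expconv_def
  proof (rule integral_dominated_convergence[where w = "\<lambda>t. h t powr s"])
    show "integrable lborel (\<lambda>t. h t powr s)" by fact
    show "AE u in lborel. (\<lambda>j. expker l (X j - u) * h u powr s) \<longlonglongrightarrow> 0"
      by (intro AE_I2 tendsto_mult_left_zero expker_tendsto_0 assms)
    show "AE u in lborel. norm (expker l (X j - u) * h u powr s) \<le> h u powr s" for j
      by (intro AE_I2) (auto simp: abs_mult intro!: mult_left_le_one_le expker_le_one)
  qed measurable
  then have lim: "(\<lambda>j. \<bar>l\<bar> * expconv l (\<lambda>u. h u powr s) (X j)) \<longlonglongrightarrow> 0"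
    by (auto intro!: tendsto_eq_intros)
  have "(\<lambda>j. (\<bar>l\<bar> * expconv l (\<lambda>u. h u powr s) (X j)) powr (1 / s)) \<longlonglongrightarrow> 0 powr (1 / s)"
    by (rule tendsto_powr'[OF lim tendsto_const]) (use assms(3) in \<open>auto simp: expconv_nonneg\<close>)
  then have "(\<lambda>j. (\<bar>l\<bar> * expconv l (\<lambda>u. h u powr s) (X j)) powr (1 / s)) \<longlonglongrightarrow> 0"
    by simp
  moreover have "\<bar>l\<bar> * expconv l h (X j) \<le> (\<bar>l\<bar> * expconv l (\<lambda>u. h u powr s) (X j)) powr (1 / s)" for j
  proof -
    have "((\<bar>l\<bar> * expconv l h (X j)) powr s) powr (1 / s) \<le> (\<bar>l\<bar> * expconv l (\<lambda>u. h u powr s) (X j)) powr (1 / s)"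
      using expconv_powr_le[OF assms(1-3)] assms(3) by (intro powr_mono2) auto
    then show ?thesis using assms(3) by (simp add: powr_powr expconv_nonneg profile_nonneg[OF assms(2)])
  qed
  moreover have "0 \<le> \<bar>l\<bar> * expconv l h (X j)" for j
    by (simp add: expconv_nonneg profile_nonneg[OF assms(2)])
  ultimately have "(\<lambda>j. \<bar>l\<bar> * expconv l h (X j)) \<longlonglongrightarrow> 0"
    by (intro tendsto_sandwich[OF _ _ tendsto_const, of 0 "\<lambda>j. \<bar>l\<bar> * expconv l h (X j)"]
          eventuallyI) assumption+
  from tendsto_mult_left[OF this, of "1 / \<bar>l\<bar>"] show ?thesis using assms(1) by simp
qed

text \<open>The function \<open>exp (l * t) * expconv l h t\<close> is monotone, so a zero propagates along a half line.\<close>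

lemma expconv_eq_0_halfline:
  assumes "l \<noteq> 0" "profile h" "expconv l h t0 = 0" "sgn l * (t0 - t) \<ge> 0"
  shows "expconv l h t = 0"
proof -
  have d: "((\<lambda>t. exp (l * t) * expconv l h t) has_real_derivative (sgn l * exp (l * u) * h u)) (at u)" for u
    by (rule derivative_eq_intros expconv_deriv assms refl | simp)+ (simp add: algebra_simps)
  have "exp (l * t) * expconv l h t \<le> exp (l * t0) * expconv l h t0"
    (is "?G t \<le> ?G t0")
  proof (cases "l > 0")
    case True
    show ?thesis
    proof (rule DERIV_nonneg_imp_nondecreasing[of t t0 ?G])
      show "t \<le> t0" using True assms by simp
      show "\<exists>y. (?G has_real_derivative y) (at u) \<and> 0 \<le> y" for u
        by (rule exI[of _ "sgn l * exp (l * u) * h u"], rule conjI, rule d)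
          (simp add: True profile_nonneg[OF assms(2)])
    qed
  next
    case False
    then have l: "l < 0" using assms by simp
    show ?thesis
    proof (rule DERIV_nonpos_imp_nonincreasing[of t0 t ?G])
      show "t0 \<le> t" using l assms by simp
      show "\<exists>y. (?G has_real_derivative y) (at u) \<and> y \<le> 0" for u
        by (rule exI[of _ "sgn l * exp (l * u) * h u"], rule conjI, rule d)
          (simp add: l profile_nonneg[OF assms(2)])
    qed
  qed
  then have "expconv l h t \<le> 0" using assms(3) by (simp add: mult_le_0_iff)
  moreover have "0 \<le> expconv l h t" using assms by (intro expconv_nonneg profile_nonneg)
  ultimately show ?thesis by simp
qed

lemma expconv_eq_0_imp:
  assumes "l \<noteq> 0" "profile h" "expconv l h t0 = 0" "sgn l * (t0 - t) > 0"
  shows "h t = 0"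
proof -
  have "((\<lambda>_. 0) has_real_derivative (sgn l * h t - l * expconv l h t)) (at t)"
  proof (rule has_field_derivative_transform_within_open[OF expconv_deriv[OF assms(1,2)]])
    show "open {u. sgn l * (t0 - u) > 0}" by (intro open_Collect_less continuous_intros)
  qed (use assms expconv_eq_0_halfline[OF assms(1-3)] in auto)
  from DERIV_unique[OF this DERIV_const] have "sgn l * h t = l * expconv l h t" by simp
  also have "\<dots> = 0" using expconv_eq_0_halfline[OF assms(1-3), of t] assms by simp
  finally show ?thesis using assms by (simp add: sgn_zero_iff)
qed


section \<open>The Green operator\<close>

text \<open>The Green operator: up to the sign \<open>- sgn (a * b)\<close> it inverts \<open>(D + a)(D - b)\<close> on bounded
  functions. Exchanging \<open>a\<close> and \<open>b\<close> gives its adjoint.\<close>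

definition green :: "real \<Rightarrow> real \<Rightarrow> (real \<Rightarrow> real) \<Rightarrow> real \<Rightarrow> real" where
  "green a b h = expconv a (expconv (- b) h)"

context
  fixes a b :: real
  assumes ab: "a \<noteq> 0" "b \<noteq> 0"
begin

lemma profile_green: "profile h \<Longrightarrow> profile (green a b h)"
  using ab by (simp add: green_def profile_expconv)

lemma green_shift: "green a b (\<lambda>s. h (s + c)) t = green a b h (t + c)"
  by (simp add: green_def expconv_shift[abs_def])

lemma green_cmult: "green a b (\<lambda>s. c * h s) t = c * green a b h t"
  by (simp add: green_def expconv_cmult[abs_def])

lemma green_adjoint:
  assumes "profile h" "profile k"
  shows "(\<integral>t. k t * green a b h t \<partial>lborel) = (\<integral>t. h t * green b a k t \<partial>lborel)"
proof -
  have "(\<integral>t. k t * green a b h t \<partial>lborel) = (\<integral>t. expconv (- a) k t * expconv (- b) h t \<partial>lborel)"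
    unfolding green_def using ab assms by (intro integral_expconv_adjoint profile_expconv) auto
  also have "\<dots> = (\<integral>t. expconv (- (- b)) (expconv (- a) k) t * h t \<partial>lborel)"
    using ab assms by (intro integral_expconv_adjoint profile_expconv) auto
  finally show ?thesis by (simp add: green_def mult.commute)
qed

lemma green_nonneg: "profile h \<Longrightarrow> 0 \<le> green a b h t"
  using profile_green profile_nonneg by blast

lemma green_unit_profile_le:
  assumes "s > 1" "unit_profile s h"
  shows "green a b h t \<le> (1 + 1 / \<bar>b\<bar>) / \<bar>a\<bar>"
  unfolding green_def using ab assms expconv_unit_profile_le[of "- b" s h]
  by (intro expconv_le profile_expconv) (auto simp: unit_profile_def)

lemma green_unit_profile_lipschitz:
  assumes "s > 1" "unit_profile s h"
  shows "\<bar>green a b h t - green a b h u\<bar> \<le> 2 * (1 + 1 / \<bar>b\<bar>) * \<bar>t - u\<bar>"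
proof -
  define M where "M = 1 + 1 / \<bar>b\<bar>"
  have h: "profile h" using assms by (auto simp: unit_profile_def)
  have H: "profile (expconv (- b) h)" using profile_expconv h ab by simp
  have HM: "expconv (- b) h t \<le> M" for t
    using expconv_unit_profile_le[of "- b" s h] assms ab by (simp add: M_def)
  have "norm (green a b h t - green a b h u) \<le> 2 * M * norm (t - u)"
  proof (rule field_differentiable_bound[OF convex_UNIV])
    show "(green a b h has_field_derivative (sgn a * expconv (- b) h x - a * green a b h x)) (at x within UNIV)" for x
      unfolding green_def using expconv_deriv[OF ab(1) H] by simp
    show "norm (sgn a * expconv (- b) h x - a * green a b h x) \<le> 2 * M" for x
    proof -
      have "\<bar>sgn a * expconv (- b) h x\<bar> \<le> M"
        using HM[of x] profile_nonneg[OF H, of x] ab by (simp add: abs_mult)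
      moreover have "\<bar>a * green a b h x\<bar> \<le> M"
      proof -
        have "\<bar>a\<bar> * green a b h x \<le> \<bar>a\<bar> * (M / \<bar>a\<bar>)"
          using green_unit_profile_le[OF assms] unfolding M_def by (rule mult_left_mono) simp
        then show ?thesis using ab green_nonneg[OF h, of x] by (simp add: abs_mult)
      qed
      ultimately show ?thesis unfolding real_norm_def by linarith
    qed
  qed auto
  then show ?thesis by (simp add: M_def)
qed

lemma integrable_green_powr:
  assumes "profile h" "s > 1" "integrable lborel (\<lambda>t. h t powr s)"
  shows "integrable lborel (\<lambda>t. green a b h t powr s)"
  unfolding green_def
  using ab assms by (intro integrable_expconv_powr profile_expconv) auto

lemma integral_green_powr_le:
  assumes "profile h" "s > 1" "integrable lborel (\<lambda>t. h t powr s)"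
  shows "(\<bar>a\<bar> * \<bar>b\<bar>) powr s * (\<integral>t. green a b h t powr s \<partial>lborel) \<le> (\<integral>t. h t powr s \<partial>lborel)"
proof -
  have b: "- b \<noteq> 0" using ab by simp
  have "(\<bar>a\<bar> * \<bar>b\<bar>) powr s * (\<integral>t. green a b h t powr s \<partial>lborel)
     = \<bar>b\<bar> powr s * (\<bar>a\<bar> powr s * (\<integral>t. green a b h t powr s \<partial>lborel))"
    by (simp add: powr_mult)
  also have "\<dots> \<le> \<bar>b\<bar> powr s * (\<integral>t. expconv (- b) h t powr s \<partial>lborel)"
    unfolding green_def
    using ab b assms by (intro mult_left_mono integral_expconv_powr_le integrable_expconv_powr profile_expconv) auto
  also have "\<dots> \<le> (\<integral>t. h t powr s \<partial>lborel)"
    using integral_expconv_powr_le[OF b assms] by simp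
  finally show ?thesis .
qed

lemma green_powr_interpolate:
  assumes "profile h" "s < q" "\<And>t. green a b h t \<le> M"
  shows "green a b h t powr q \<le> M powr (q - s) * green a b h t powr s"
proof -
  have "green a b h t powr q = green a b h t powr (q - s) * green a b h t powr s"
    by (simp flip: powr_add)
  also have "\<dots> \<le> M powr (q - s) * green a b h t powr s"
    using assms green_nonneg[OF assms(1)] by (intro mult_right_mono powr_mono2) auto
  finally show ?thesis .
qed

lemma
  assumes "profile h" "1 < s" "s < q" "integrable lborel (\<lambda>t. h t powr s)" "\<And>t. green a b h t \<le> M"
  shows integrable_green_powr_greater: "integrable lborel (\<lambda>t. green a b h t powr q)"
    and integral_green_powr_greater_le: "(\<integral>t. green a b h t powr q \<partial>lborel)
      \<le> M powr (q - s) * ((\<integral>t. h t powr s \<partial>lborel) / (\<bar>a\<bar> * \<bar>b\<bar>) powr s)"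
proof -
  note [measurable] = profile_measurable[OF profile_green[OF assms(1)]]
  note le = green_powr_interpolate[OF assms(1,3,5)]
  have int: "integrable lborel (\<lambda>t. M powr (q - s) * green a b h t powr s)"
    using integrable_green_powr[OF assms(1,2,4)] by simp
  show *: "integrable lborel (\<lambda>t. green a b h t powr q)"
    by (rule Bochner_Integration.integrable_bound[OF int]) (auto intro!: AE_I2 le)
  have "(\<integral>t. green a b h t powr q \<partial>lborel) \<le> (\<integral>t. M powr (q - s) * green a b h t powr s \<partial>lborel)"
    by (rule integral_mono[OF * int le])
  also have "\<dots> = M powr (q - s) * (\<integral>t. green a b h t powr s \<partial>lborel)" by simp
  also have "\<dots> \<le> M powr (q - s) * ((\<integral>t. h t powr s \<partial>lborel) / (\<bar>a\<bar> * \<bar>b\<bar>) powr s)"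
    using integral_green_powr_le[OF assms(1,2,4)] ab
    by (intro mult_left_mono) (auto simp: field_simps)
  finally show "(\<integral>t. green a b h t powr q \<partial>lborel)
      \<le> M powr (q - s) * ((\<integral>t. h t powr s \<partial>lborel) / (\<bar>a\<bar> * \<bar>b\<bar>) powr s)" .
qed

lemma green_tendsto:
  assumes h: "\<And>j. profile (h j)" and k: "profile k"
    and "\<And>j t. h j t \<le> C" "\<And>t. (\<lambda>j. h j t) \<longlonglongrightarrow> k t"
  shows "(\<lambda>j. green a b (h j) t) \<longlonglongrightarrow> green a b k t"
  unfolding green_def
proof (rule expconv_tendsto)
  have b: "- b \<noteq> 0" using ab by simp
  show "(\<lambda>j. expconv (- b) (h j) t) \<longlonglongrightarrow> expconv (- b) k t" for t
    using assms by (intro expconv_tendsto[where C = C] b) (auto simp: profile_measurable profile_nonneg[OF h])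
  show "\<bar>expconv (- b) (h j) t\<bar> \<le> C / \<bar>- b\<bar>" for j t
    using expconv_le[OF b h assms(3), of j t] by (simp add: expconv_nonneg profile_nonneg[OF h])
qed (use ab assms in \<open>auto intro!: profile_measurable profile_expconv\<close>)

lemma green_tendsto_0:
  assumes "profile h" "s > 1" "integrable lborel (\<lambda>t. h t powr s)"
    and "filterlim X at_top sequentially \<or> filterlim X at_bot sequentially"
  shows "(\<lambda>j. green a b h (X j)) \<longlonglongrightarrow> 0"
  unfolding green_def
  by (rule expconv_tendsto_0[where s = s])
     (use ab assms in \<open>auto intro!: integrable_expconv_powr profile_expconv\<close>)

text \<open>For \<open>a, b > 0\<close> the inner convolution looks forward and the outer one backward, so a zero of
  the Green potential propagates to the whole line.\<close>

lemma green_pos: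
  assumes "profile h" "green a b h t0 > 0" "a > 0" "b > 0"
  shows "green a b h t > 0"
proof (rule ccontr)
  assume "\<not> green a b h t > 0"
  then have z: "expconv a (expconv (- b) h) t = 0"
    using green_nonneg[OF assms(1), of t] by (simp add: green_def)
  have b: "- b \<noteq> 0" using ab by simp
  have H: "profile (expconv (- b) h)" using profile_expconv b assms by simp
  have 1: "expconv (- b) h u = 0" if "u < t" for u
    using expconv_eq_0_imp[OF ab(1) H z, of u] that assms by simp
  have 2: "expconv (- b) h u = 0" if "u \<ge> t - 1" for u
    using expconv_eq_0_halfline[OF b assms(1) 1[of "t - 1"], of u] that assms by simp
  have "expconv (- b) h = (\<lambda>_. 0)"
  proof (intro ext)
    show "expconv (- b) h u = 0" for u
      using 1[of u] 2[of u] by (cases "u < t") auto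
  qed
  then have "green a b h t0 = 0"
    using expconv_const[OF ab(1), of 0] by (simp add: green_def)
  then show False using assms by simp
qed

lemma green_deriv:
  assumes "profile h"
  obtains f' f'' where "\<And>t. (green a b h has_real_derivative f' t) (at t)"
    "\<And>t. (f' has_real_derivative f'' t) (at t)" "continuous_on UNIV f''"
    "\<And>t. f'' t + (a - b) * f' t - a * b * green a b h t = - sgn (a * b) * h t"
proof -
  have b: "- b \<noteq> 0" using ab by simp
  define H where "H = expconv (- b) h"
  define f where "f = green a b h"
  have H: "profile H" unfolding H_def using profile_expconv b assms by simp
  define f' where "f' t = sgn a * H t - a * f t" for t
  define H' where "H' t = b * H t - sgn b * h t" for t
  define f'' where "f'' t = sgn a * H' t - a * f' t" for t
  have f: "(f has_real_derivative f' t) (at t)" for t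
    using expconv_deriv[OF ab(1) H] by (simp add: f_def f'_def green_def H_def)
  have dH: "(H has_real_derivative H' t) (at t)" for t
    using expconv_deriv[OF b assms] by (simp add: H_def H'_def sgn_minus)
  have f': "(f' has_real_derivative f'' t) (at t)" for t
    unfolding f'_def[abs_def] f''_def
    by (rule derivative_eq_intros f dH refl | simp)+ (simp add: f'_def)
  have "continuous_on UNIV H" "continuous_on UNIV f" "continuous_on UNIV h"
    using H profile_green assms by (auto simp: f_def intro: profile_continuous)
  then have c: "continuous_on UNIV f''"
    unfolding f''_def H'_def f'_def by (intro continuous_intros)
  have "f'' t + (a - b) * f' t - a * b * f t = - sgn (a * b) * h t" for t
    by (simp add: f''_def f'_def H'_def algebra_simps sgn_mult)
  with f f' c show ?thesis using that unfolding f_def by blast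
qed

end


section \<open>Duality and compactness tools\<close>

text \<open>The norm with exponent \<open>q\<close> of a nonnegative function. By the convention for integrals it is
  \<open>0\<close> when \<open>F powr q\<close> is not integrable.\<close>

definition lnorm :: "real \<Rightarrow> (real \<Rightarrow> real) \<Rightarrow> real" where
  "lnorm q F = (\<integral>t. F t powr q \<partial>lborel) powr (1 / q)"

text \<open>The norming functional of \<open>F\<close>: the unit vector of the dual Lebesgue space whose pairing with
  \<open>F\<close> is the norm of \<open>F\<close>.\<close>

definition dual_profile :: "real \<Rightarrow> (real \<Rightarrow> real) \<Rightarrow> real \<Rightarrow> real" where
  "dual_profile q F t = (F t / lnorm q F) powr (q - 1)"

text \<open>The gap in Young's inequality for \<open>k\<close> and the normalised function \<open>F / lnorm q F\<close>; its integral
  measures how far \<open>k\<close> is from norming \<open>F\<close>.\<close>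

definition Young_gap :: "real \<Rightarrow> real \<Rightarrow> (real \<Rightarrow> real) \<Rightarrow> (real \<Rightarrow> real) \<Rightarrow> real \<Rightarrow> real" where
  "Young_gap q r F k t = k t powr r / r + (F t / lnorm q F) powr q / q - k t * F t / lnorm q F"

lemma lnorm_powr: "q > 0 \<Longrightarrow> lnorm q F powr q = (\<integral>t. F t powr q \<partial>lborel)"
  by (simp add: lnorm_def powr_powr Bochner_Integration.integral_nonneg)

lemma powr_minus_one_mult:
  fixes x :: real assumes "0 \<le> x" shows "x powr (q - 1) * x = x powr q"
  using powr_add[of x "q - 1" 1] assms by (cases "x = 0") auto

context
  fixes q \<sigma> :: real and F :: "real \<Rightarrow> real"
  assumes q: "q > 1" "1 / q + 1 / \<sigma> = 1"
    and F: "profile F" "integrable lborel (\<lambda>t. F t powr q)" "lnorm q F > 0"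
begin

lemma integrable_normalized: "integrable lborel (\<lambda>t. (F t / lnorm q F) powr q)"
  using F by (simp add: powr_divide profile_nonneg)

lemma integral_normalized: "(\<integral>t. (F t / lnorm q F) powr q \<partial>lborel) = 1"
proof -
  have "(\<integral>t. (F t / lnorm q F) powr q \<partial>lborel) = (\<integral>t. F t powr q / lnorm q F powr q \<partial>lborel)"
    using F by (intro Bochner_Integration.integral_cong) (auto simp: powr_divide profile_nonneg)
  also have "\<dots> = lnorm q F powr q / lnorm q F powr q"
    using q by (simp add: lnorm_powr)
  also have "\<dots> = 1" using F by simp
  finally show ?thesis .
qed

lemma unit_profile_dual: "unit_profile \<sigma> (dual_profile q F)"
proof -
  note qs = conjugate_exponents[OF q]
  have "dual_profile q F t powr \<sigma> = (F t / lnorm q F) powr q" for t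
    by (simp add: dual_profile_def powr_powr qs)
  moreover have "profile (dual_profile q F)"
    unfolding dual_profile_def[abs_def] using F q by (intro profile_powr profile_divide) auto
  ultimately show ?thesis
    by (simp add: unit_profile_def integrable_normalized integral_normalized)
qed

lemma integral_dual_profile: "(\<integral>t. dual_profile q F t * F t \<partial>lborel) = lnorm q F"
proof -
  have "dual_profile q F t * F t = lnorm q F * (F t / lnorm q F) powr q" for t
    using powr_minus_one_mult[of "F t / lnorm q F" q] F
    by (simp add: dual_profile_def profile_nonneg field_simps)
  then show ?thesis by (simp add: integral_normalized)
qed

context
  fixes k :: "real \<Rightarrow> real"
  assumes k: "unit_profile \<sigma> k"
begin

lemma
  shows integrable_Young_gap: "integrable lborel (Young_gap q \<sigma> F k)"
    and Young_gap_nonneg: "0 \<le> Young_gap q \<sigma> F k t"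
    and integral_Young_gap: "(\<integral>t. Young_gap q \<sigma> F k t \<partial>lborel) \<le> 1 - (\<integral>t. k t * F t \<partial>lborel) / lnorm q F"
    and pairing_le: "(\<integral>t. k t * F t \<partial>lborel) \<le> lnorm q F"
proof -
  have kp: "profile k" "integrable lborel (\<lambda>t. k t powr \<sigma>)" "(\<integral>t. k t powr \<sigma> \<partial>lborel) \<le> 1"
    using k by (auto simp: unit_profile_def)
  note [measurable] = profile_measurable[OF kp(1)] profile_measurable[OF F(1)]
  note qs = conjugate_exponents[OF q]
  note nn = profile_nonneg[OF kp(1)] profile_nonneg[OF F(1)]
  have Y: "F t / lnorm q F * k t \<le> (F t / lnorm q F) powr q / q + k t powr \<sigma> / \<sigma>" for t
    using F nn q by (intro Young_weak) auto
  then show gap: "0 \<le> Young_gap q \<sigma> F k t" for t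
    using Y[of t] by (simp add: Young_gap_def mult.commute add.commute)
  have int: "integrable lborel (\<lambda>t. (F t / lnorm q F) powr q / q + k t powr \<sigma> / \<sigma>)"
    using integrable_normalized kp by auto
  have "integrable lborel (\<lambda>t. F t / lnorm q F * k t)"
  proof (rule Bochner_Integration.integrable_bound[OF int])
    show "AE t in lborel. norm (F t / lnorm q F * k t) \<le> norm ((F t / lnorm q F) powr q / q + k t powr \<sigma> / \<sigma>)"
    proof (rule AE_I2)
      fix t
      have "0 \<le> F t / lnorm q F * k t" using nn F(3) by simp
      with Y[of t] show "norm (F t / lnorm q F * k t) \<le> norm ((F t / lnorm q F) powr q / q + k t powr \<sigma> / \<sigma>)"
        by simp
    qed
  qed measurable
  then have "integrable lborel (\<lambda>t. lnorm q F * (F t / lnorm q F * k t))"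
    by (rule integrable_mult_right)
  then have p: "integrable lborel (\<lambda>t. k t * F t)"
    using F(3) by (simp add: mult.commute)
  then have p': "integrable lborel (\<lambda>t. k t * F t / lnorm q F)" by simp
  show D: "integrable lborel (Young_gap q \<sigma> F k)"
    unfolding Young_gap_def[abs_def] using integrable_normalized kp p' by auto
  have "(\<integral>t. Young_gap q \<sigma> F k t \<partial>lborel) = (\<integral>t. k t powr \<sigma> \<partial>lborel) / \<sigma>
      + 1 / q - (\<integral>t. k t * F t \<partial>lborel) / lnorm q F"
    unfolding Young_gap_def[abs_def] using integrable_normalized kp p'
    by (simp add: integral_normalized)
  also have "\<dots> \<le> 1 / \<sigma> + 1 / q - (\<integral>t. k t * F t \<partial>lborel) / lnorm q F"
    using kp qs(1) by (intro diff_right_mono add_right_mono divide_right_mono) auto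
  finally show gi: "(\<integral>t. Young_gap q \<sigma> F k t \<partial>lborel) \<le> 1 - (\<integral>t. k t * F t \<partial>lborel) / lnorm q F"
    using q by simp
  have "0 \<le> (\<integral>t. Young_gap q \<sigma> F k t \<partial>lborel)"
    by (rule Bochner_Integration.integral_nonneg) (rule gap)
  with gi have "(\<integral>t. k t * F t \<partial>lborel) / lnorm q F \<le> 1" by linarith
  then show "(\<integral>t. k t * F t \<partial>lborel) \<le> lnorm q F"
    using F(3) by (simp add: field_simps)
qed

end
end

lemma lnorm_nonneg: "0 \<le> lnorm q F"
  by (simp add: lnorm_def)

lemma lnorm_eq_0_imp:
  assumes "profile F" "integrable lborel (\<lambda>t. F t powr q)" "lnorm q F = 0" "q > 0"
  shows "AE t in lborel. F t = 0"
proof -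
  have "(\<integral>t. F t powr q \<partial>lborel) = 0"
    using lnorm_powr[of q F] assms by simp
  then have "AE t in lborel. F t powr q = 0"
    using integral_nonneg_eq_0_iff_AE[OF assms(2)] by simp
  then show ?thesis by simp
qed

lemma continuous_AE_eq_0_imp:
  fixes f :: "real \<Rightarrow> real"
  assumes "continuous_on UNIV f" "AE t in lborel. f t = 0"
  shows "f t = 0"
proof -
  have "closed (f -` {0})"
    using assms(1) by (intro closed_vimage) (auto simp: continuous_on_eq_continuous_at)
  moreover have "AE t in lebesgue. t \<in> f -` {0}"
    using assms(2) by (auto intro: AE_completion)
  ultimately show ?thesis
    using mem_closed_if_AE_lebesgue by blast
qed

lemma Fatou_integral:
  fixes f :: "nat \<Rightarrow> real \<Rightarrow> real"
  assumes int: "\<And>j. integrable lborel (f j)" and nonneg: "\<And>j t. 0 \<le> f j t"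
    and lim: "\<And>t. (\<lambda>j. f j t) \<longlonglongrightarrow> g t"
    and le: "\<And>j. (\<integral>t. f j t \<partial>lborel) \<le> c j" and c: "c \<longlonglongrightarrow> C"
  shows "integrable lborel g" "(\<integral>t. g t \<partial>lborel) \<le> C"
proof -
  have [measurable]: "f j \<in> borel_measurable lborel" for j using int by auto
  have [measurable]: "g \<in> borel_measurable lborel"
    by (rule borel_measurable_LIMSEQ_real[OF lim]) auto
  have g0: "0 \<le> g t" for t
    using LIMSEQ_le_const[OF lim] nonneg by blast
  have "(\<integral>\<^sup>+t. ennreal (g t) \<partial>lborel) = (\<integral>\<^sup>+t. liminf (\<lambda>j. ennreal (f j t)) \<partial>lborel)"
    by (intro nn_integral_cong lim_imp_Liminf[symmetric]) (auto intro!: tendsto_ennrealI lim)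
  also have "\<dots> \<le> liminf (\<lambda>j. \<integral>\<^sup>+t. ennreal (f j t) \<partial>lborel)"
    by (rule nn_integral_liminf) measurable
  also have "\<dots> \<le> liminf (\<lambda>j. ennreal (c j))"
    by (intro Liminf_mono always_eventually allI)
       (simp add: nn_integral_eq_integral int nonneg le ennreal_leI)
  also have "\<dots> = ennreal C"
    by (intro lim_imp_Liminf) (auto intro!: tendsto_ennrealI c)
  finally have *: "(\<integral>\<^sup>+t. ennreal (g t) \<partial>lborel) \<le> ennreal C" .
  show gi: "integrable lborel g"
    by (rule integrableI_nonneg) (use g0 le_less_trans[OF *] in auto)
  have "0 \<le> c j" for j
    using le[of j] Bochner_Integration.integral_nonneg[of lborel "f j"] nonneg by (meson order_trans)
  then have "0 \<le> C" using LIMSEQ_le_const[OF c] by blast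
  then show "(\<integral>t. g t \<partial>lborel) \<le> C"
    using * g0 by (simp add: nn_integral_eq_integral[OF gi] ennreal_le_iff)
qed

text \<open>The part of the Arzela-Ascoli theorem that is needed, on the whole line and with
  pointwise convergence only.\<close>

lemma equi_lipschitz_convergent_subsequence:
  fixes G :: "nat \<Rightarrow> real \<Rightarrow> real"
  assumes bnd: "\<And>j t. \<bar>G j t\<bar> \<le> M" and lip: "\<And>j t u. \<bar>G j t - G j u\<bar> \<le> L * \<bar>t - u\<bar>"
  obtains r G' where "strict_mono (r :: nat \<Rightarrow> nat)" "\<And>t. (\<lambda>j. G (r j) t) \<longlonglongrightarrow> G' t"
    "continuous_on UNIV G'"
proof -
  obtain r where r: "strict_mono (r :: nat \<Rightarrow> nat)" "\<And>t. t \<in> \<rat> \<Longrightarrow> \<exists>l. (\<lambda>j. G (r j) t) \<longlonglongrightarrow> l"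
    using function_convergent_subsequence[OF countable_rat, of G M] bnd by (auto simp: real_norm_def)
  have L0: "0 \<le> L" using lip[of 0 1 0] by simp
  have "Cauchy (\<lambda>j. G (r j) t)" for t
  proof (rule CauchyI)
    fix e :: real assume e: "e > 0"
    obtain w where w: "w \<in> \<rat>" "t < w" "w < t + e / (3 * (L + 1))"
      using Rats_dense_in_real[of t "t + e / (3 * (L + 1))"] e L0 by auto
    have "L * \<bar>t - w\<bar> \<le> (L + 1) * (e / (3 * (L + 1)))"
      using w L0 by (intro mult_mono) auto
    also have "\<dots> = e / 3"
      using L0 by (auto simp: divide_simps)
    finally have near: "\<bar>G j t - G j w\<bar> \<le> e / 3" for j
      using lip[of j t w] by linarith
    have "Cauchy (\<lambda>j. G (r j) w)" using r(2)[OF w(1)] convergent_Cauchy convergent_def by blast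
    then obtain N where N: "\<And>m n. m \<ge> N \<Longrightarrow> n \<ge> N \<Longrightarrow> \<bar>G (r m) w - G (r n) w\<bar> < e / 3"
      using CauchyD[of "\<lambda>j. G (r j) w" "e / 3"] e by auto
    have "\<bar>G (r m) t - G (r n) t\<bar> < e" if "m \<ge> N" "n \<ge> N" for m n
      using near[of "r m"] near[of "r n"] N[OF that] by (simp add: abs_if split: if_splits)
    then show "\<exists>N. \<forall>m\<ge>N. \<forall>n\<ge>N. norm (G (r m) t - G (r n) t) < e" by auto
  qed
  then obtain G' where G': "\<And>t. (\<lambda>j. G (r j) t) \<longlonglongrightarrow> G' t"
    unfolding Cauchy_convergent_iff convergent_def by metis
  have "\<bar>G' t - G' u\<bar> \<le> L * \<bar>t - u\<bar>" for t u
  proof (rule LIMSEQ_le_const2)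
    show "(\<lambda>j. \<bar>G (r j) t - G (r j) u\<bar>) \<longlonglongrightarrow> \<bar>G' t - G' u\<bar>"
      by (intro tendsto_intros G')
  qed (use lip in auto)
  then have "L-lipschitz_on UNIV G'"
    using L0 by (auto simp: lipschitz_on_def dist_real_def)
  then have "continuous_on UNIV G'" by (rule lipschitz_on_continuous_on)
  with that r(1) G' show ?thesis by blast
qed


section \<open>The best constant\<close>

lemma unit_profile_shift:
  assumes "unit_profile s h" shows "unit_profile s (\<lambda>t. h (t + c))"
proof -
  have "profile (\<lambda>t. h (t + c))"
    by (rule profile_comp[of h "\<lambda>t. t + c"]) (use assms in \<open>auto simp: unit_profile_def intro: continuous_intros\<close>)
  moreover have "integrable lborel (\<lambda>t. h (t + c) powr s)"
    using assms lborel_integrable_real_affine[of "\<lambda>t. h t powr s" 1 c]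
    by (simp add: unit_profile_def add.commute)
  moreover have "(\<integral>t. h (t + c) powr s \<partial>lborel) = (\<integral>t. h t powr s \<partial>lborel)"
    using lborel_integral_real_affine[of 1 "\<lambda>t. h t powr s" c] by (simp add: add.commute)
  ultimately show ?thesis using assms by (simp add: unit_profile_def)
qed

lemma expconv_pos:
  assumes "l \<noteq> 0" "profile h" "\<And>t. h t > 0"
  shows "expconv l h t > 0"
proof -
  have "expconv l h t \<noteq> 0"
  proof
    assume "expconv l h t = 0"
    from expconv_eq_0_imp[OF assms(1,2) this, of "t - sgn l"] assms(1)
    have "h (t - sgn l) = 0" by (simp add: sgn_if split: if_splits)
    then show False using assms(3)[of "t - sgn l"] by simp
  qed
  then show ?thesis using expconv_nonneg[of h l t] profile_nonneg[OF assms(2)] by (simp add: less_le)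
qed

lemma exists_positive_unit_profile:
  assumes "s > 1" obtains h where "unit_profile s h" "\<And>t. h t > 0"
proof -
  let ?h = "\<lambda>t::real. exp (- \<bar>t\<bar>) / 2"
  have eq: "AE t in lborel. (expker 1 t + expker (- 1) t) / 2 = ?h t"
    using AE_lborel_singleton[of 0] by eventually_elim (auto simp: expker_def)
  have "integrable lborel (\<lambda>t. (expker 1 t + expker (- 1) t) / 2)"
    using integrable_expker[of 1] integrable_expker[of "-1"] by auto
  then have int: "integrable lborel ?h"
    by (subst (asm) integrable_cong_AE[OF _ _ eq]) auto
  have "(\<integral>t. ?h t \<partial>lborel) = (\<integral>t. (expker 1 t + expker (- 1) t) / 2 \<partial>lborel)"
    by (rule integral_cong_AE) (use eq in auto)
  also have "\<dots> = 1"
    using integrable_expker[of 1] integrable_expker[of "-1"] by (simp add: integral_expker)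
  finally have one: "(\<integral>t. ?h t \<partial>lborel) = 1" .
  have h1: "?h t \<le> 1" for t
  proof -
    have "exp (- \<bar>t\<bar>) \<le> 1" by simp
    then show ?thesis by linarith
  qed
  have le: "?h t powr s \<le> ?h t" for t
    using powr_mono'[of 1 s "?h t"] assms h1[of t] by simp
  have "profile ?h"
    by (rule profileI[OF _ _ h1]) (auto intro!: continuous_intros)
  moreover have ints: "integrable lborel (\<lambda>t. ?h t powr s)"
  proof (rule Bochner_Integration.integrable_bound[OF int])
    show "AE t in lborel. norm (?h t powr s) \<le> norm (?h t)"
    proof (rule AE_I2)
      fix t :: real
      have "norm (?h t powr s) = ?h t powr s" "norm (?h t) = ?h t" by auto
      with le[of t] show "norm (?h t powr s) \<le> norm (?h t)" by (simp only:)
    qed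
  qed measurable
  moreover have "(\<integral>t. ?h t powr s \<partial>lborel) \<le> 1"
    using integral_mono[OF ints int le] one by simp
  ultimately have "unit_profile s ?h" by (simp add: unit_profile_def)
  then show ?thesis by (rule that) simp
qed

lemma integrable_green_unit_profile:
  assumes "a \<noteq> 0" "b \<noteq> 0" "1 < s" "s < q" "unit_profile s h"
  shows "integrable lborel (\<lambda>t. green a b h t powr q)"
  using assms green_unit_profile_le[OF assms(1-3,5)]
  by (intro integrable_green_powr_greater[where s = s]) (auto simp: unit_profile_def)

text \<open>Passing to the norming functional cannot decrease the norm, since
  \<open>\<parallel>T h\<parallel> = \<integral> k T h = \<integral> h T' k \<le> \<parallel>T' k\<parallel>\<close> for the norming functional \<open>k\<close> of \<open>T h\<close>.\<close>

lemma dual_profile_increases_lnorm: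
  assumes ab: "a \<noteq> 0" "b \<noteq> 0" and s: "1 < s" "1 / s + 1 / p = 1" and q: "s < q" "1 / q + 1 / \<sigma> = 1"
    and h: "unit_profile s h" and pos: "lnorm q (green a b h) > 0"
  shows "unit_profile \<sigma> (dual_profile q (green a b h))"
    and "lnorm q (green a b h) \<le> lnorm p (green b a (dual_profile q (green a b h)))"
proof -
  define k where "k = dual_profile q (green a b h)"
  have q1: "q > 1" using s q by simp
  note cs = conjugate_exponents[OF s] and cq = conjugate_exponents[OF q1 q(2)]
  have "1 / q < 1 / s" using q s by (intro divide_strict_left_mono) auto
  then have "1 / p < 1 / \<sigma>" using s(2) q(2) by linarith
  then have sp: "\<sigma> < p" using cs(1) cq(1) by (simp add: field_simps)
  have hp: "profile h" using h by (simp add: unit_profile_def)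
  have F: "profile (green a b h)" "integrable lborel (\<lambda>t. green a b h t powr q)"
    using profile_green[OF ab hp] integrable_green_unit_profile[OF ab s(1) q(1) h] by auto
  show k: "unit_profile \<sigma> (dual_profile q (green a b h))"
    by (rule unit_profile_dual) fact+
  have kp: "profile k" using k by (simp add: unit_profile_def k_def)
  have G: "profile (green b a k)" "integrable lborel (\<lambda>t. green b a k t powr p)"
    using profile_green[OF ab(2,1) kp] integrable_green_unit_profile[OF ab(2,1) cq(1) sp] k
    by (auto simp: k_def)
  have eq: "lnorm q (green a b h) = (\<integral>t. h t * green b a k t \<partial>lborel)"
    using green_adjoint[OF ab hp kp] integral_dual_profile[OF q1 q(2) F pos] by (simp add: k_def)
  show "lnorm q (green a b h) \<le> lnorm p (green b a (dual_profile q (green a b h)))"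
  proof (cases "lnorm p (green b a k) = 0")
    case True
    note [measurable] = profile_measurable[OF hp] profile_measurable[OF G(1)]
    have "AE t in lborel. green b a k t = 0"
      using lnorm_eq_0_imp[OF G True] cs(1) by simp
    then have "(\<integral>t. h t * green b a k t \<partial>lborel) = (\<integral>t. 0 \<partial>(lborel :: real measure))"
      by (intro integral_cong_AE) auto
    with eq pos show ?thesis by simp
  next
    case False
    then have "lnorm p (green b a k) > 0" using lnorm_nonneg[of p "green b a k"] by simp
    moreover have "1 / p + 1 / s = 1" using s by simp
    ultimately show ?thesis
      unfolding eq k_def[symmetric] using pairing_le[OF cs(1) _ G _ h] by blast
  qed
qed

text \<open>The norm of the Green operator from exponent \<open>s\<close> to exponent \<open>q\<close>, as a supremum over
  nonnegative bounded continuous functions.\<close>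

definition best_const :: "real \<Rightarrow> real \<Rightarrow> real \<Rightarrow> real \<Rightarrow> real" where
  "best_const a b s q = Sup ((\<lambda>h. lnorm q (green a b h)) ` {h. unit_profile s h})"

context
  fixes a b s q p \<sigma> :: real
  assumes ab: "a \<noteq> 0" "b \<noteq> 0" and s: "1 < s" "1 / s + 1 / p = 1" and q: "s < q" "1 / q + 1 / \<sigma> = 1"
begin

text \<open>Interpolation between the uniform bound \<open>M\<close> and exponent \<open>s\<close>. Besides finiteness of the best
  constant it shows that near-extremal functions have potentials that are not uniformly small.\<close>

lemma lnorm_green_le:
  assumes "unit_profile s h" "\<And>t. green a b h t \<le> M"
  shows "lnorm q (green a b h) powr q \<le> M powr (q - s) / (\<bar>a\<bar> * \<bar>b\<bar>) powr s"
proof -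
  have h: "profile h" "integrable lborel (\<lambda>t. h t powr s)" "(\<integral>t. h t powr s \<partial>lborel) \<le> 1"
    using assms by (auto simp: unit_profile_def)
  have "lnorm q (green a b h) powr q = (\<integral>t. green a b h t powr q \<partial>lborel)"
    using s q by (simp add: lnorm_powr)
  also have "\<dots> \<le> M powr (q - s) * ((\<integral>t. h t powr s \<partial>lborel) / (\<bar>a\<bar> * \<bar>b\<bar>) powr s)"
    by (rule integral_green_powr_greater_le[OF ab h(1) s(1) q(1) h(2) assms(2)])
  also have "\<dots> \<le> M powr (q - s) * (1 / (\<bar>a\<bar> * \<bar>b\<bar>) powr s)"
    using h by (intro mult_left_mono divide_right_mono) auto
  finally show ?thesis by simp
qed

lemma lnorm_le_best_const:
  assumes "unit_profile s h" shows "lnorm q (green a b h) \<le> best_const a b s q"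
  unfolding best_const_def
proof (rule cSup_upper)
  define B where "B = ((1 + 1 / \<bar>b\<bar>) / \<bar>a\<bar>) powr (q - s) / (\<bar>a\<bar> * \<bar>b\<bar>) powr s"
  have "lnorm q (green a b h) \<le> B powr (1 / q)" if "unit_profile s h" for h
  proof -
    have "lnorm q (green a b h) = (lnorm q (green a b h) powr q) powr (1 / q)"
      using s q by (simp add: powr_powr lnorm_nonneg)
    also have "\<dots> \<le> B powr (1 / q)"
      using s q lnorm_green_le[OF that green_unit_profile_le[OF ab s(1) that]]
      by (intro powr_mono2) (auto simp: B_def)
    finally show ?thesis .
  qed
  then show "bdd_above ((\<lambda>h. lnorm q (green a b h)) ` {h. unit_profile s h})"
    by (auto intro!: bdd_aboveI2)
qed (use assms in auto)

lemma best_const_pos: "best_const a b s q > 0"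
proof -
  obtain h where h: "unit_profile s h" "\<And>t. h t > 0" using exists_positive_unit_profile[OF s(1)] by blast
  have hp: "profile h" using h by (simp add: unit_profile_def)
  have pos: "green a b h t > 0" for t
    unfolding green_def using ab h hp by (intro expconv_pos profile_expconv) auto
  have "lnorm q (green a b h) \<noteq> 0"
  proof
    assume "lnorm q (green a b h) = 0"
    then have "AE t in lborel. green a b h t = 0"
      using lnorm_eq_0_imp[OF profile_green[OF ab hp] integrable_green_unit_profile[OF ab s(1) q(1) h(1)]] s q
      by simp
    from continuous_AE_eq_0_imp[OF profile_continuous[OF profile_green[OF ab hp]] this]
    show False using pos[of 0] by simp
  qed
  then have "0 < lnorm q (green a b h)" using lnorm_nonneg[of q "green a b h"] by simp
  also have "\<dots> \<le> best_const a b s q" by (rule lnorm_le_best_const[OF h(1)])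
  finally show ?thesis .
qed

lemma near_maximiser:
  assumes "e > 0"
  obtains h where "unit_profile s h" "lnorm q (green a b h) > best_const a b s q - e"
proof -
  obtain h0 where "unit_profile s h0" using exists_positive_unit_profile[OF s(1)] by blast
  then have "(\<lambda>h. lnorm q (green a b h)) ` {h. unit_profile s h} \<noteq> {}" by auto
  then obtain y where "y \<in> (\<lambda>h. lnorm q (green a b h)) ` {h. unit_profile s h}" "best_const a b s q - e < y"
    using less_cSupE[of "best_const a b s q - e"] assms unfolding best_const_def by (metis diff_less_eq less_add_same_cancel1)
  with that show ?thesis by auto
qed

end


section \<open>Existence of a dual pair of extremals\<close>

context
  fixes a b s q p \<sigma> :: real
  assumes ab: "a \<noteq> 0" "b \<noteq> 0" and s: "1 < s" "1 / s + 1 / p = 1" and q: "s < q" "1 / q + 1 / \<sigma> = 1"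
begin

text \<open>Approximate extremals: the equation for \<open>h\<close> holds exactly with a constant \<open>c\<close>, while the
  equation expressing \<open>k\<close> through \<open>h\<close> holds only in the sense that the integrated Young gap, with
  normalising constant \<open>d\<close>, is at most \<open>1 - c / d\<close>. Both constants lie within \<open>e\<close> of the best
  constant. The function \<open>G\<close> records \<open>k\<close> before taking the power.\<close>

definition almost_solution ::
  "real \<Rightarrow> (real \<Rightarrow> real) \<Rightarrow> (real \<Rightarrow> real) \<Rightarrow> (real \<Rightarrow> real) \<Rightarrow> real \<Rightarrow> real \<Rightarrow> bool" where
  "almost_solution e G k h c d \<longleftrightarrow>
     k = (\<lambda>t. G t powr (q - 1)) \<and> unit_profile \<sigma> k \<and>
     h = (\<lambda>t. (green b a k t / c) powr (p - 1)) \<and> unit_profile s h \<and>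
     best_const a b s q - e \<le> c \<and> c \<le> d \<and> d \<le> best_const a b s q \<and>
     (\<forall>t. 0 \<le> k t powr \<sigma> / \<sigma> + (green a b h t / d) powr q / q - k t * green a b h t / d) \<and>
     integrable lborel (\<lambda>t. k t powr \<sigma> / \<sigma> + (green a b h t / d) powr q / q - k t * green a b h t / d) \<and>
     (\<integral>t. k t powr \<sigma> / \<sigma> + (green a b h t / d) powr q / q - k t * green a b h t / d \<partial>lborel) \<le> 1 - c / d"

lemma almost_solution_shift:
  assumes "almost_solution e G k h c d"
  shows "almost_solution e (\<lambda>t. G (t + t0)) (\<lambda>t. k (t + t0)) (\<lambda>t. h (t + t0)) c d"
proof -
  let ?D = "\<lambda>t. k t powr \<sigma> / \<sigma> + (green a b h t / d) powr q / q - k t * green a b h t / d"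
  have 1: "green a b (\<lambda>t. h (t + t0)) t = green a b h (t + t0)" for t
    by (rule green_shift[OF ab])
  have 2: "green b a (\<lambda>t. k (t + t0)) t = green b a k (t + t0)" for t
    by (rule green_shift[OF ab(2,1)])
  have "integrable lborel ?D \<Longrightarrow> integrable lborel (\<lambda>t. ?D (t + t0))"
    using lborel_integrable_real_affine[of ?D 1 t0] by (simp add: add.commute)
  moreover have "(\<integral>t. ?D (t + t0) \<partial>lborel) = (\<integral>t. ?D t \<partial>lborel)"
    using lborel_integral_real_affine[of 1 ?D t0] by (simp add: add.commute)
  moreover have "h (t + t0) = (green b a k (t + t0) / c) powr (p - 1)"
      "k (t + t0) = G (t + t0) powr (q - 1)" for t
    using assms unfolding almost_solution_def by metis+
  ultimately show ?thesis
    using assms unfolding almost_solution_def 1 2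
    by (intro conjI allI unit_profile_shift ext) auto
qed

lemma exists_almost_solution_unshifted:
  assumes e: "0 < e" "e \<le> best_const a b s q / 2"
  obtains G k h c d where "almost_solution e G k h c d" "profile G" "d = lnorm q (green a b h)"
    "\<And>t. G t \<le> 2 * ((1 + 1 / \<bar>b\<bar>) / \<bar>a\<bar>) / best_const a b s q"
    "\<And>t u. \<bar>G t - G u\<bar> \<le> 4 * (1 + 1 / \<bar>b\<bar>) / best_const a b s q * \<bar>t - u\<bar>"
proof -
  define S where "S = best_const a b s q"
  note asm = ab s q
  have S: "S > 0" unfolding S_def by (rule best_const_pos[OF asm])
  have q1: "q > 1" using s q by simp
  note cs = conjugate_exponents[OF s] and cq = conjugate_exponents[OF q1 q(2)]
  have "1 / q < 1 / s" using q s by (intro divide_strict_left_mono) auto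
  then have "1 / p < 1 / \<sigma>" using s(2) q(2) by linarith
  then have sp: "\<sigma> < p" using cs(1) cq(1) by (simp add: field_simps)
  have s': "1 / p + 1 / s = 1" and q': "1 / \<sigma> + 1 / q = 1" using s q by auto
  obtain h0 where h0: "unit_profile s h0" "lnorm q (green a b h0) > S - e"
    using near_maximiser[OF asm e(1)] unfolding S_def by blast
  have h0p: "profile h0" using h0 by (simp add: unit_profile_def)
  define N where "N = lnorm q (green a b h0)"
  have N: "N \<ge> S / 2" "N > 0" using h0(2) e S by (auto simp: N_def S_def)
  define G where "G t = green a b h0 t / N" for t
  define k where "k = dual_profile q (green a b h0)"
  have kG: "k = (\<lambda>t. G t powr (q - 1))" by (simp add: k_def G_def N_def dual_profile_def fun_eq_iff)
  define c where "c = lnorm p (green b a k)"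
  have k: "unit_profile \<sigma> k" and Nc: "N \<le> c"
    using dual_profile_increases_lnorm[OF asm h0(1)] N unfolding N_def k_def c_def by auto
  have kp: "profile k" using k by (simp add: unit_profile_def)
  have c: "c > 0" using N Nc by simp
  define h where "h = dual_profile p (green b a k)"
  define d where "d = lnorm q (green a b h)"
  have h: "unit_profile s h" and cd: "c \<le> d"
    using dual_profile_increases_lnorm[OF ab(2,1) cq(1) q' sp s' k] c unfolding c_def h_def d_def by auto
  have hp: "profile h" using h by (simp add: unit_profile_def)
  have dS: "d \<le> S" unfolding d_def S_def by (rule lnorm_le_best_const[OF asm h])
  have d: "d > 0" using c cd by simp
  have F: "profile (green a b h)" "integrable lborel (\<lambda>t. green a b h t powr q)"
    using profile_green[OF ab hp] integrable_green_unit_profile[OF ab s(1) q(1) h] by auto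
  have G': "profile (green b a k)" "integrable lborel (\<lambda>t. green b a k t powr p)"
    using profile_green[OF ab(2,1) kp] integrable_green_unit_profile[OF ab(2,1) cq(1) sp k] by auto
  have "(\<integral>t. k t * green a b h t \<partial>lborel) = (\<integral>t. h t * green b a k t \<partial>lborel)"
    by (rule green_adjoint[OF ab hp kp])
  also have "\<dots> = c"
    using integral_dual_profile[OF cs(1) s' G'] c by (simp add: h_def c_def)
  finally have kc: "(\<integral>t. k t * green a b h t \<partial>lborel) = c" .
  have d': "lnorm q (green a b h) > 0" using d by (simp add: d_def)
  note gap = integrable_Young_gap[OF q1 q(2) F d' k] Young_gap_nonneg[OF q1 q(2) F d' k]
    integral_Young_gap[OF q1 q(2) F d' k]
  note gap = gap[unfolded Young_gap_def[abs_def] d_def[symmetric] kc]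
  have "h = (\<lambda>t. (green b a k t / c) powr (p - 1))"
    by (simp add: h_def c_def dual_profile_def fun_eq_iff)
  moreover have "best_const a b s q - e \<le> c" "d \<le> best_const a b s q"
    using h0(2) Nc dS by (auto simp: N_def S_def)
  ultimately have "almost_solution e G k h c d"
    unfolding almost_solution_def using gap k h cd kG by blast
  moreover have "profile G"
    unfolding G_def using N profile_green[OF ab h0p] by (intro profile_divide) auto
  moreover have div: "x / N \<le> 2 * y / S" if "x \<le> y" "0 \<le> y" for x y
  proof -
    have "x / N \<le> y / N" using that N by (intro divide_right_mono) auto
    also have "\<dots> \<le> y / (S / 2)" using that N S by (intro divide_left_mono) auto
    finally show ?thesis by (simp add: mult.commute)
  qed
  moreover have "G t \<le> 2 * ((1 + 1 / \<bar>b\<bar>) / \<bar>a\<bar>) / S" for t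
    unfolding G_def by (intro div green_unit_profile_le[OF ab s(1) h0(1)]) auto
  moreover have "\<bar>G t - G u\<bar> \<le> 4 * (1 + 1 / \<bar>b\<bar>) / S * \<bar>t - u\<bar>" for t u
  proof -
    have "\<bar>G t - G u\<bar> = \<bar>green a b h0 t - green a b h0 u\<bar> / N"
      using N by (simp add: G_def flip: diff_divide_distrib)
    also have "\<dots> \<le> 2 * (2 * (1 + 1 / \<bar>b\<bar>) * \<bar>t - u\<bar>) / S"
      by (intro div green_unit_profile_lipschitz[OF ab s(1) h0(1)]) auto
    also have "2 * (2 * m * x) / S = 4 * m / S * x" for m x :: real by simp
    finally show ?thesis .
  qed
  ultimately show ?thesis
    using that[of G k h c d] unfolding S_def d_def by blast
qed

text \<open>The bounds \<open>\<delta>\<close>, \<open>M\<close> and \<open>L\<close> do not depend on \<open>e\<close>.\<close>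

lemma exists_almost_solution:
  obtains \<delta> M L where "\<delta> > 0" and "\<And>e. 0 < e \<Longrightarrow> e \<le> best_const a b s q / 2 \<Longrightarrow>
     \<exists>G k h c d. almost_solution e G k h c d \<and> profile G \<and> \<delta> \<le> green a b h 0 \<and>
       (\<forall>t. G t \<le> M) \<and> (\<forall>t u. \<bar>G t - G u\<bar> \<le> L * \<bar>t - u\<bar>)"
proof -
  define S where "S = best_const a b s q"
  have S: "S > 0" unfolding S_def by (rule best_const_pos[OF ab s q])
  \<comment> \<open>\<open>\<delta>\<close> is so small that a potential bounded by it would have norm below \<open>S / 2\<close>.\<close>
  define x where "x = (S / 2) powr q * (\<bar>a\<bar> * \<bar>b\<bar>) powr s / 2"
  define \<delta> where "\<delta> = x powr (1 / (q - s))"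
  have x: "x > 0" using S ab by (simp add: x_def)
  then have \<delta>: "\<delta> > 0" by (simp add: \<delta>_def)
  have "\<delta> powr (q - s) = x" using x q by (simp add: \<delta>_def powr_powr)
  then have \<delta>': "\<delta> powr (q - s) / (\<bar>a\<bar> * \<bar>b\<bar>) powr s < (S / 2) powr q"
  proof -
    have w: "(\<bar>a\<bar> * \<bar>b\<bar>) powr s > 0" "(S / 2) powr q > 0" using ab S by auto
    then have "x / (\<bar>a\<bar> * \<bar>b\<bar>) powr s = (S / 2) powr q / 2" by (simp add: x_def)
    also have "\<dots> < (S / 2) powr q" using w by simp
    finally show ?thesis using \<open>\<delta> powr (q - s) = x\<close> by simp
  qed
  show ?thesis
  proof (rule that[OF \<delta>])
    fix e :: real
    assume e: "0 < e" "e \<le> best_const a b s q / 2"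
    obtain G k h c d where as: "almost_solution e G k h c d" "profile G" "d = lnorm q (green a b h)"
      and G: "\<And>t. G t \<le> 2 * ((1 + 1 / \<bar>b\<bar>) / \<bar>a\<bar>) / best_const a b s q"
      "\<And>t u. \<bar>G t - G u\<bar> \<le> 4 * (1 + 1 / \<bar>b\<bar>) / best_const a b s q * \<bar>t - u\<bar>"
      using exists_almost_solution_unshifted[OF e] by blast
    have h: "unit_profile s h" and d: "S / 2 \<le> d"
      using as(1) e by (auto simp: almost_solution_def S_def)
    have "\<exists>t0. \<delta> < green a b h t0"
    proof (rule ccontr)
      assume "\<nexists>t0. \<delta> < green a b h t0"
      then have "lnorm q (green a b h) powr q \<le> \<delta> powr (q - s) / (\<bar>a\<bar> * \<bar>b\<bar>) powr s"
        by (intro lnorm_green_le[OF ab s q h]) (auto simp: not_less)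
      also have "\<dots> < (S / 2) powr q" by (rule \<delta>')
      also have "\<dots> \<le> d powr q" using d S s q by (intro powr_mono2) auto
      finally show False by (simp add: as(3))
    qed
    then obtain t0 where t0: "\<delta> < green a b h t0" by blast
    have "profile (\<lambda>t. G (t + t0))"
      by (rule profile_comp[of G "\<lambda>t. t + t0"]) (use as in \<open>auto intro: continuous_intros\<close>)
    moreover have "\<bar>G (t + t0) - G (u + t0)\<bar> \<le> 4 * (1 + 1 / \<bar>b\<bar>) / best_const a b s q * \<bar>t - u\<bar>" for t u
      using G(2)[of "t + t0" "u + t0"] by simp
    moreover have "\<delta> \<le> green a b (\<lambda>t. h (t + t0)) 0"
      using t0 by (simp add: green_shift[OF ab])
    ultimately show "\<exists>G k h c d. almost_solution e G k h c d \<and> profile G \<and> \<delta> \<le> green a b h 0 \<and>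
       (\<forall>t. G t \<le> 2 * ((1 + 1 / \<bar>b\<bar>) / \<bar>a\<bar>) / best_const a b s q) \<and>
       (\<forall>t u. \<bar>G t - G u\<bar> \<le> 4 * (1 + 1 / \<bar>b\<bar>) / best_const a b s q * \<bar>t - u\<bar>)"
      using almost_solution_shift[OF as(1), of t0] G(1) by blast
  qed
qed

lemma exists_maximiser_equations:
  obtains h k S where "S > 0" "profile h" "profile k"
    "integrable lborel (\<lambda>t. h t powr s)" "integrable lborel (\<lambda>t. k t powr \<sigma>)"
    "h = (\<lambda>t. (green b a k t / S) powr (p - 1))" "k = (\<lambda>t. (green a b h t / S) powr (q - 1))"
    "green a b h 0 > 0"
proof -
  define S where "S = best_const a b s q"
  have S: "S > 0" unfolding S_def by (rule best_const_pos[OF ab s q])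
  have q1: "q > 1" using s q by simp
  note cs = conjugate_exponents[OF s] and cq = conjugate_exponents[OF q1 q(2)]
  obtain \<delta> M L where \<delta>: "\<delta> > 0" and ex: "\<And>e. 0 < e \<Longrightarrow> e \<le> S / 2 \<Longrightarrow>
     \<exists>G k h c d. almost_solution e G k h c d \<and> profile G \<and> \<delta> \<le> green a b h 0 \<and>
       (\<forall>t. G t \<le> M) \<and> (\<forall>t u. \<bar>G t - G u\<bar> \<le> L * \<bar>t - u\<bar>)"
    using exists_almost_solution unfolding S_def by blast
  define e where "e j = S / 2 / real (Suc j)" for j
  have e: "0 < e j" "e j \<le> S / 2" for j
    using S by (auto simp: e_def field_simps)
  have e0: "e \<longlonglongrightarrow> 0"
    unfolding e_def by real_asymp
  have "\<forall>j. \<exists>G k h c d. almost_solution (e j) G k h c d \<and> profile G \<and> \<delta> \<le> green a b h 0 \<and>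
       (\<forall>t. G t \<le> M) \<and> (\<forall>t u. \<bar>G t - G u\<bar> \<le> L * \<bar>t - u\<bar>)"
    using ex[OF e] by blast
  then obtain G k h c d where as: "\<And>j. almost_solution (e j) (G j) (k j) (h j) (c j) (d j)"
    and Gp: "\<And>j. profile (G j)" and \<delta>h: "\<And>j. \<delta> \<le> green a b (h j) 0"
    and GM: "\<And>j t. G j t \<le> M" and GL: "\<And>j t u. \<bar>G j t - G j u\<bar> \<le> L * \<bar>t - u\<bar>"
    by metis
  have "\<bar>G j t\<bar> \<le> M" for j t using GM profile_nonneg[OF Gp] by simp
  then obtain r G' where r: "strict_mono (r :: nat \<Rightarrow> nat)" and G': "\<And>t. (\<lambda>j. G (r j) t) \<longlonglongrightarrow> G' t"
    and G'c: "continuous_on UNIV G'"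
    using equi_lipschitz_convergent_subsequence[of G M L] GL by blast
  define k' where "k' t = G' t powr (q - 1)" for t
  have G'0: "0 \<le> G' t" and G'M: "G' t \<le> M" for t
    using LIMSEQ_le_const[OF G'] LIMSEQ_le_const2[OF G'] GM profile_nonneg[OF Gp] by blast+
  have G'p: "profile G'" using G'c G'0 G'M by (rule profileI)
  have k'p: "profile k'" unfolding k'_def[abs_def] using q1 G'p by (intro profile_powr) auto
  have kG: "k j t = G j t powr (q - 1)" for j t using as[of j] by (simp add: almost_solution_def)
  have ku: "unit_profile \<sigma> (k j)" and hu: "unit_profile s (h j)" for j
    using as[of j] by (auto simp: almost_solution_def)
  have kp: "profile (k j)" and hp: "profile (h j)" for j
    using ku hu by (auto simp: unit_profile_def)
  have k_lim: "(\<lambda>j. k (r j) t) \<longlonglongrightarrow> k' t" for t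
    unfolding kG k'_def
    by (rule tendsto_powr'[OF G' tendsto_const]) (use q1 in \<open>auto simp: profile_nonneg[OF Gp]\<close>)
  have kM: "k j t \<le> M powr (q - 1)" for j t
    unfolding kG using q1 by (intro powr_mono2 GM) (auto simp: profile_nonneg[OF Gp])
  have Tk_lim: "(\<lambda>j. green b a (k (r j)) t) \<longlonglongrightarrow> green b a k' t" for t
    by (rule green_tendsto[OF ab(2,1) kp k'p kM k_lim])
  have er: "(\<lambda>j. e (r j)) \<longlonglongrightarrow> 0"
    using LIMSEQ_subseq_LIMSEQ[OF e0 r] by (simp add: o_def)
  have cd: "S - e j \<le> c j" "c j \<le> d j" "d j \<le> S" for j
    using as[of j] by (auto simp: almost_solution_def S_def)
  have c0: "S / 2 \<le> c j" for j using cd(1)[of j] e(2)[of j] by linarith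
  have Se: "(\<lambda>j. S - e (r j)) \<longlonglongrightarrow> S" using tendsto_diff[OF tendsto_const er] by simp
  have c_lim: "(\<lambda>j. c (r j)) \<longlonglongrightarrow> S"
    by (rule tendsto_sandwich[OF _ _ Se tendsto_const]) (use cd order_trans[OF cd(1,2)] order_trans[OF cd(2,3)] in \<open>auto intro!: always_eventually\<close>)
  have d_lim: "(\<lambda>j. d (r j)) \<longlonglongrightarrow> S"
    by (rule tendsto_sandwich[OF _ _ Se tendsto_const]) (use cd order_trans[OF cd(1,2)] order_trans[OF cd(2,3)] in \<open>auto intro!: always_eventually\<close>)
  define h' where "h' t = (green b a k' t / S) powr (p - 1)" for t
  have Tkp: "profile (green b a k')" "profile (green b a (k j))" for j
    using profile_green[OF ab(2,1)] kp k'p by auto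
  have h'p: "profile h'"
    unfolding h'_def[abs_def] using Tkp S cs(1) by (intro profile_powr profile_divide) auto
  have hk: "h j t = (green b a (k j) t / c j) powr (p - 1)" for j t
    using as[of j] by (simp add: almost_solution_def)
  have h_lim: "(\<lambda>j. h (r j) t) \<longlonglongrightarrow> h' t" for t
    unfolding hk h'_def
  proof (rule tendsto_powr'[OF tendsto_divide[OF Tk_lim c_lim] tendsto_const])
    have "0 \<le> green b a (k (r j)) t / c (r j)" for j
      using profile_nonneg[OF Tkp(2)] c0[of "r j"] S by simp
    then show "green b a k' t / S \<noteq> 0 \<or> 0 < p - 1 \<and> (\<forall>\<^sub>F j in sequentially. 0 \<le> green b a (k (r j)) t / c (r j))"
      using cs(1) by simp
  qed (use S in auto)
  define B where "B = ((1 + 1 / \<bar>a\<bar>) / \<bar>b\<bar> / (S / 2)) powr (p - 1)"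
  have hB: "h j t \<le> B" for j t
    unfolding hk B_def
  proof (rule powr_mono2)
    show "green b a (k j) t / c j \<le> (1 + 1 / \<bar>a\<bar>) / \<bar>b\<bar> / (S / 2)"
      using green_unit_profile_le[OF ab(2,1) cq(1) ku] c0[of j] S
      by (intro frac_le) auto
    show "0 \<le> green b a (k j) t / c j" using profile_nonneg[OF Tkp(2)] c0[of j] S by simp
  qed (use cs in auto)
  have F_lim: "(\<lambda>j. green a b (h (r j)) t) \<longlonglongrightarrow> green a b h' t" for t
    by (rule green_tendsto[OF ab hp h'p hB h_lim])
  have F0: "\<delta> \<le> green a b h' 0"
    using LIMSEQ_le_const[OF F_lim[of 0]] \<delta>h by blast
  have Fp: "profile (green a b h')" "profile (green a b (h j))" for j
    using profile_green[OF ab] hp h'p by auto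
  \<comment> \<open>Fatou: the limits stay in the Lebesgue spaces, and their Young gap integrates to zero.\<close>
  have int_h: "integrable lborel (\<lambda>t. h' t powr s)"
  proof (rule Fatou_integral(1)[where f = "\<lambda>j t. h (r j) t powr s" and c = "\<lambda>_. 1"])
    show "(\<lambda>j. h (r j) t powr s) \<longlonglongrightarrow> h' t powr s" for t
      by (rule tendsto_powr'[OF h_lim tendsto_const]) (use s in \<open>auto simp: profile_nonneg[OF hp]\<close>)
  qed (use hu in \<open>auto simp: unit_profile_def\<close>)
  have k_lim_powr: "(\<lambda>j. k (r j) t powr \<sigma>) \<longlonglongrightarrow> k' t powr \<sigma>" for t
    by (rule tendsto_powr'[OF k_lim tendsto_const]) (use cq in \<open>auto simp: profile_nonneg[OF kp]\<close>)
  have int_k: "integrable lborel (\<lambda>t. k' t powr \<sigma>)"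
    by (rule Fatou_integral(1)[where f = "\<lambda>j t. k (r j) t powr \<sigma>" and c = "\<lambda>_. 1"])
       (use ku k_lim_powr in \<open>auto simp: unit_profile_def\<close>)
  define D where "D j t = k j t powr \<sigma> / \<sigma> + (green a b (h j) t / d j) powr q / q - k j t * green a b (h j) t / d j" for j t
  define D' where "D' t = k' t powr \<sigma> / \<sigma> + (green a b h' t / S) powr q / q - k' t * green a b h' t / S" for t
  have D: "integrable lborel (D j)" "0 \<le> D j t" "(\<integral>t. D j t \<partial>lborel) \<le> 1 - c j / d j" for j t
    using as[of j] by (auto simp: almost_solution_def D_def[abs_def])
  have D_lim: "(\<lambda>j. D (r j) t) \<longlonglongrightarrow> D' t" for t
  proof -
    have Fd: "(\<lambda>j. green a b (h (r j)) t / d (r j)) \<longlonglongrightarrow> green a b h' t / S"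
      by (rule tendsto_divide[OF F_lim d_lim]) (use S in simp)
    have Fd0: "0 \<le> green a b (h (r j)) t / d (r j)" for j
      using profile_nonneg[OF Fp(2)] c0[of "r j"] cd(2)[of "r j"] S by simp
    have Fq: "(\<lambda>j. (green a b (h (r j)) t / d (r j)) powr q) \<longlonglongrightarrow> (green a b h' t / S) powr q"
      by (rule tendsto_powr'[OF Fd tendsto_const]) (use q1 Fd0 in auto)
    have kF: "(\<lambda>j. k (r j) t * green a b (h (r j)) t / d (r j)) \<longlonglongrightarrow> k' t * green a b h' t / S"
      by (rule tendsto_divide[OF tendsto_mult[OF k_lim F_lim] d_lim]) (use S in simp)
    show ?thesis
      unfolding D_def D'_def
      by (rule tendsto_diff[OF tendsto_add[OF tendsto_divide[OF k_lim_powr tendsto_const]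
            tendsto_divide[OF Fq tendsto_const]] kF]) (use q1 cq(1) in auto)
  qed
  have "(\<lambda>j. 1 - c (r j) / d (r j)) \<longlonglongrightarrow> 1 - S / S"
    by (rule tendsto_diff[OF tendsto_const tendsto_divide[OF c_lim d_lim]]) (use S in simp)
  then have lim0: "(\<lambda>j. 1 - c (r j) / d (r j)) \<longlonglongrightarrow> 0" using S by simp
  note D' = Fatou_integral[of "\<lambda>j. D (r j)", OF D(1) D(2) D_lim D(3) lim0]
  have D'0: "0 \<le> D' t" for t using LIMSEQ_le_const[OF D_lim] D(2) by blast
  have "(\<integral>t. D' t \<partial>lborel) = 0"
    using D'(2) Bochner_Integration.integral_nonneg[of lborel D'] D'0 by (simp add: order_antisym)
  then have "AE t in lborel. D' t = 0"
    using integral_nonneg_eq_0_iff_AE[OF D'(1)] D'0 by simp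
  moreover have "continuous_on UNIV D'"
  proof -
    have c: "continuous_on UNIV (\<lambda>t. k' t powr \<sigma>)" "continuous_on UNIV (\<lambda>t. (green a b h' t / S) powr q)"
      using S q1 cq(1) k'p Fp(1) by (auto intro!: profile_continuous profile_powr profile_divide)
    then show ?thesis
      unfolding D'_def using S q1 cq(1)
      by (intro continuous_on_diff continuous_on_add continuous_on_divide continuous_on_mult
          continuous_on_const c profile_continuous[OF k'p] profile_continuous[OF Fp(1)]) auto
  qed
  ultimately have D'z: "D' t = 0" for t using continuous_AE_eq_0_imp by blast
  have "k' t = (green a b h' t / S) powr (q - 1)" for t
  proof (rule ccontr)
    assume ne: "k' t \<noteq> (green a b h' t / S) powr (q - 1)"
    have "1 / \<sigma> + 1 / q = 1" using q by simp
    from Young_strict[OF cq(1) this _ _ ne] have "0 < D' t"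
      using profile_nonneg[OF k'p] profile_nonneg[OF Fp(1)] S by (simp add: D'_def)
    then show False by (simp add: D'z)
  qed
  then have "k' = (\<lambda>t. (green a b h' t / S) powr (q - 1))" by blast
  moreover have "h' = (\<lambda>t. (green b a k' t / S) powr (p - 1))" by (simp add: h'_def fun_eq_iff)
  moreover have "green a b h' 0 > 0" using \<delta> F0 by linarith
  ultimately show ?thesis
    using that[of S h' k'] S h'p k'p int_h int_k by blast
qed

end


section \<open>Homoclinic solutions of the autonomous system\<close>

lemma green_limits:
  assumes "a \<noteq> 0" "b \<noteq> 0" "profile h" "s > 1" "integrable lborel (\<lambda>t. h t powr s)"
  shows "(green a b h \<longlongrightarrow> 0) at_top" "(green a b h \<longlongrightarrow> 0) at_bot"
proof -
  show "(green a b h \<longlongrightarrow> 0) at_top"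
    by (rule tendsto_at_topI_sequentially) (rule green_tendsto_0[OF assms], simp)
  show "(green a b h \<longlongrightarrow> 0) at_bot"
    unfolding filterlim_at_bot_mirror
  proof (rule tendsto_at_topI_sequentially)
    fix X :: "nat \<Rightarrow> real" assume "filterlim X at_top sequentially"
    then show "(\<lambda>j. green a b h (- X j)) \<longlonglongrightarrow> 0"
      by (intro green_tendsto_0[OF assms]) (simp add: filterlim_uminus_at_bot)
  qed
qed

text \<open>The constant \<open>S\<close> is removed by replacing \<open>h\<close>, \<open>k\<close> by \<open>exp x * h\<close>, \<open>exp y * k\<close>. The linear
  equations for \<open>x\<close> and \<open>y\<close> are solvable because \<open>(p - 1) * (q - 1) \<noteq> 1\<close>.\<close>

lemma exists_dual_pair:
  assumes ab: "a \<noteq> 0" "b \<noteq> 0" and pq: "p > 1" "q > 1" "1 / p + 1 / q < 1"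
  obtains h k where "profile h" "profile k"
    "integrable lborel (\<lambda>t. h t powr (p / (p - 1)))" "integrable lborel (\<lambda>t. k t powr (q / (q - 1)))"
    "h = (\<lambda>t. green b a k t powr (p - 1))" "k = (\<lambda>t. green a b h t powr (q - 1))"
    "green a b h 0 > 0"
proof -
  define s \<sigma> where "s = p / (p - 1)" and "\<sigma> = q / (q - 1)"
  have s: "1 < s" "1 / s + 1 / p = 1" and \<sigma>: "1 / q + 1 / \<sigma> = 1"
    using pq by (auto simp: s_def \<sigma>_def field_simps)
  have "1 / q < 1 / s" using s(2) pq(3) by linarith
  then have sq: "s < q" using s pq by (simp add: field_simps)
  obtain h k S where S: "S > 0" and hk: "profile h" "profile k"
    "integrable lborel (\<lambda>t. h t powr s)" "integrable lborel (\<lambda>t. k t powr \<sigma>)"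
    "h = (\<lambda>t. (green b a k t / S) powr (p - 1))" "k = (\<lambda>t. (green a b h t / S) powr (q - 1))"
    "green a b h 0 > 0"
    using exists_maximiser_equations[OF ab s sq \<sigma>] by blast
  define e where "e = 1 - (p - 1) * (q - 1)"
  have e: "e \<noteq> 0"
  proof
    assume "e = 0"
    then have "p + q = p * q" by (simp add: e_def algebra_simps)
    then have "1 / p + 1 / q = 1" using pq by (simp add: field_simps)
    then show False using pq by simp
  qed
  define x where "x = (p - 1) * q * ln S / e"
  define y where "y = (q - 1) * (x + ln S)"
  have "x * e = (p - 1) * q * ln S" using e by (simp add: x_def)
  then have xy: "x = (p - 1) * (y + ln S)" by (simp add: e_def y_def algebra_simps)
  define h' where "h' t = exp x * h t" for t
  define k' where "k' t = exp y * k t" for t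
  have Th: "green a b h' t = exp x * green a b h t" and Tk: "green b a k' t = exp y * green b a k t" for t
    unfolding h'_def[abs_def] k'_def[abs_def] by (auto intro!: green_cmult ab)
  have exp_powr: "exp u = (exp w * S) powr c" if "u = c * (w + ln S)" for u w c
    using S that by (simp add: powr_def exp_add ln_mult)
  have nn: "0 \<le> green a b h t" "0 \<le> green b a k t" for t
    using green_nonneg[OF ab hk(1)] green_nonneg[OF ab(2,1) hk(2)] by auto
  show ?thesis
  proof (rule that[of h' k'])
    show "profile h'" "profile k'"
      unfolding h'_def[abs_def] k'_def[abs_def] using hk(1,2) by (auto intro: profile_cmult)
    show "integrable lborel (\<lambda>t. h' t powr (p / (p - 1)))" "integrable lborel (\<lambda>t. k' t powr (q / (q - 1)))"
      using hk(3,4) by (auto simp: h'_def k'_def powr_mult profile_nonneg[OF hk(1)] profile_nonneg[OF hk(2)] s_def \<sigma>_def)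
    show "h' = (\<lambda>t. green b a k' t powr (p - 1))"
    proof
      fix t
      have "h' t = (exp y * S) powr (p - 1) * (green b a k t / S) powr (p - 1)"
        unfolding h'_def using exp_powr[OF xy] fun_cong[OF hk(5), of t] by simp
      also have "\<dots> = (exp y * S * (green b a k t / S)) powr (p - 1)"
        by (rule powr_mult[symmetric])
      finally show "h' t = green b a k' t powr (p - 1)" using S by (simp add: Tk)
    qed
    show "k' = (\<lambda>t. green a b h' t powr (q - 1))"
    proof
      fix t
      have "k' t = (exp x * S) powr (q - 1) * (green a b h t / S) powr (q - 1)"
        unfolding k'_def using exp_powr[OF y_def] fun_cong[OF hk(6), of t] by simp
      also have "\<dots> = (exp x * S * (green a b h t / S)) powr (q - 1)"
        by (rule powr_mult[symmetric])
      finally show "k' t = green a b h' t powr (q - 1)" using S by (simp add: Th)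
    qed
    show "green a b h' 0 > 0" using hk(7) by (simp add: Th)
  qed
qed

text \<open>\<open>f\<close> is twice continuously differentiable with first and second derivative \<open>f'\<close> and \<open>f''\<close>.\<close>

definition second_derivs :: "(real \<Rightarrow> real) \<Rightarrow> (real \<Rightarrow> real) \<Rightarrow> (real \<Rightarrow> real) \<Rightarrow> bool" where
  "second_derivs f f' f'' \<longleftrightarrow> (\<forall>t. (f has_real_derivative f' t) (at t)) \<and>
     (\<forall>t. (f' has_real_derivative f'' t) (at t)) \<and> continuous_on UNIV f''"

lemma exists_homoclinic:
  assumes ab: "a \<noteq> 0" "b \<noteq> 0" and pq: "p > 1" "q > 1" "1 / p + 1 / q < 1"
  obtains f f' f'' g g' g'' where
    "second_derivs f f' f''" "second_derivs g g' g''"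
    "\<And>t. f'' t + (a - b) * f' t - a * b * f t = - sgn (a * b) * g t powr (p - 1)"
    "\<And>t. g'' t + (b - a) * g' t - a * b * g t = - sgn (a * b) * f t powr (q - 1)"
    "\<And>t. 0 \<le> f t" "\<And>t. 0 \<le> g t" "f 0 > 0"
    "a > 0 \<and> b > 0 \<longrightarrow> (\<forall>t. f t > 0 \<and> g t > 0)"
    "integrable lborel (\<lambda>t. g t powr p)" "integrable lborel (\<lambda>t. f t powr q)"
    "(f \<longlongrightarrow> 0) at_top" "(f \<longlongrightarrow> 0) at_bot" "(g \<longlongrightarrow> 0) at_top" "(g \<longlongrightarrow> 0) at_bot"
proof -
  obtain h k where hk: "profile h" "profile k"
    "integrable lborel (\<lambda>t. h t powr (p / (p - 1)))" "integrable lborel (\<lambda>t. k t powr (q / (q - 1)))"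
    "h = (\<lambda>t. green b a k t powr (p - 1))" "k = (\<lambda>t. green a b h t powr (q - 1))"
    "green a b h 0 > 0"
    using exists_dual_pair[OF assms] by blast
  define f g where "f = green a b h" and "g = green b a k"
  have fp: "profile f" and gp: "profile g"
    unfolding f_def g_def using ab hk(1,2) by (auto intro: profile_green)
  have h_eq: "h t = g t powr (p - 1)" and k_eq: "k t = f t powr (q - 1)" for t
    using fun_cong[OF hk(5), of t] fun_cong[OF hk(6), of t] by (auto simp: f_def g_def)
  obtain f' f'' where f: "\<And>t. (f has_real_derivative f' t) (at t)"
    "\<And>t. (f' has_real_derivative f'' t) (at t)" "continuous_on UNIV f''"
    "\<And>t. f'' t + (a - b) * f' t - a * b * f t = - sgn (a * b) * h t"
    using green_deriv[OF ab hk(1)] unfolding f_def by blast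
  obtain g' g'' where g: "\<And>t. (g has_real_derivative g' t) (at t)"
    "\<And>t. (g' has_real_derivative g'' t) (at t)" "continuous_on UNIV g''"
    "\<And>t. g'' t + (b - a) * g' t - b * a * g t = - sgn (b * a) * k t"
    using green_deriv[OF ab(2,1) hk(2)] unfolding g_def by blast
  have pos: "\<forall>t. f t > 0 \<and> g t > 0" if "a > 0" "b > 0"
  proof -
    have fpos: "f t > 0" for t
      using green_pos[OF ab hk(1) hk(7) that] by (simp add: f_def)
    have "\<exists>t0. g t0 > 0"
    proof (rule ccontr)
      assume "\<nexists>t0. g t0 > 0"
      then have "g t = 0" for t using profile_nonneg[OF gp, of t] by (simp add: not_less order_antisym)
      then have "h = (\<lambda>t. 0 * h t)" by (simp add: h_eq fun_eq_iff)
      then have "f 0 = 0 * f 0" unfolding f_def by (metis green_cmult[OF ab])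
      then show False using fpos[of 0] by simp
    qed
    then obtain t0 where "green b a k t0 > 0" by (auto simp: g_def)
    from green_pos[OF ab(2,1) hk(2) this that(2,1)] fpos show ?thesis by (auto simp: g_def)
  qed
  have s: "p / (p - 1) > 1" "q / (q - 1) > 1" using pq by (auto simp: field_simps)
  have "h t powr (p / (p - 1)) = g t powr p" "k t powr (q / (q - 1)) = f t powr q" for t
    using pq by (auto simp: h_eq k_eq powr_powr)
  then have int: "integrable lborel (\<lambda>t. g t powr p)" "integrable lborel (\<lambda>t. f t powr q)"
    using hk(3,4) by auto
  note lims = green_limits[OF ab hk(1) s(1) hk(3), folded f_def]
     green_limits[OF ab(2,1) hk(2) s(2) hk(4), folded g_def]
  show ?thesis
  proof (rule that[of f f' f'' g g' g''])
    show "second_derivs f f' f''" "second_derivs g g' g''"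
      using f g by (auto simp: second_derivs_def)
    show "f'' t + (a - b) * f' t - a * b * f t = - sgn (a * b) * g t powr (p - 1)"
      "g'' t + (b - a) * g' t - a * b * g t = - sgn (a * b) * f t powr (q - 1)" for t
      using f(4)[of t] g(4)[of t] by (simp_all add: h_eq k_eq mult.commute)
    show "f 0 > 0" using hk(7) by (simp add: f_def)
  qed (use profile_nonneg fp gp pos int lims in auto)
qed


section \<open>Radial functions in logarithmic coordinates\<close>

lemma has_real_derivative_line_ln_norm:
  fixes x i :: "'a::euclidean_space"
  assumes "x \<noteq> 0"
  shows "((\<lambda>t. ln (norm (x + t *\<^sub>R i))) has_real_derivative (x \<bullet> i) / (x \<bullet> x)) (at 0)"
proof -
  have "((\<lambda>t. (x \<bullet> x + 2 * t * (x \<bullet> i) + t\<^sup>2 * (i \<bullet> i))) has_real_derivative 2 * (x \<bullet> i)) (at 0)"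
    by (auto intro!: derivative_eq_intros)
  moreover have "(\<lambda>t. (x \<bullet> x + 2 * t * (x \<bullet> i) + t\<^sup>2 * (i \<bullet> i))) = (\<lambda>t. (x + t *\<^sub>R i) \<bullet> (x + t *\<^sub>R i))"
    by (auto simp: inner_add_left inner_add_right inner_commute power2_eq_square algebra_simps)
  ultimately have d: "((\<lambda>t. (x + t *\<^sub>R i) \<bullet> (x + t *\<^sub>R i)) has_real_derivative 2 * (x \<bullet> i)) (at 0)"
    by simp
  have pos: "(x + 0 *\<^sub>R i) \<bullet> (x + 0 *\<^sub>R i) > 0" using assms by simp
  have "((\<lambda>t. ln ((x + t *\<^sub>R i) \<bullet> (x + t *\<^sub>R i)) / 2) has_real_derivative (x \<bullet> i) / (x \<bullet> x)) (at 0)"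
    using DERIV_cdivide[OF DERIV_chain2[OF DERIV_ln_divide[OF pos] d], of 2] by simp
  moreover have "(\<lambda>t. ln ((x + t *\<^sub>R i) \<bullet> (x + t *\<^sub>R i)) / 2) = (\<lambda>t. ln (norm (x + t *\<^sub>R i)))"
  proof
    fix t
    show "ln ((x + t *\<^sub>R i) \<bullet> (x + t *\<^sub>R i)) / 2 = ln (norm (x + t *\<^sub>R i))"
      by (cases "x + t *\<^sub>R i = 0") (simp_all add: dot_square_norm ln_realpow)
  qed
  ultimately show ?thesis by simp
qed

lemma eventually_line_nonzero:
  fixes x i :: "'a::euclidean_space"
  assumes "x \<noteq> 0" shows "\<forall>\<^sub>F t in nhds 0. x + t *\<^sub>R i \<noteq> 0"
proof -
  have "((\<lambda>t::real. x + t *\<^sub>R i) \<longlongrightarrow> x + 0 *\<^sub>R i) (nhds 0)"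
    by (intro tendsto_intros filterlim_ident)
  then have "\<forall>\<^sub>F t in nhds 0. x + t *\<^sub>R i \<in> - {0}"
    by (rule topological_tendstoD) (use assms in auto)
  then show ?thesis by simp
qed

lemma line_derivative_cong:
  fixes F G :: "'a::euclidean_space \<Rightarrow> real"
  assumes "x \<noteq> 0" "\<And>y. y \<noteq> 0 \<Longrightarrow> F y = G y"
    and "((\<lambda>t. F (x + t *\<^sub>R i)) has_real_derivative d) (at 0)"
  shows "((\<lambda>t. G (x + t *\<^sub>R i)) has_real_derivative d) (at 0)"
proof -
  have "\<forall>\<^sub>F t in nhds 0. F (x + t *\<^sub>R i) = G (x + t *\<^sub>R i)"
    using eventually_line_nonzero[OF assms(1)] by eventually_elim (rule assms(2))
  from DERIV_cong_ev[OF refl this refl] assms(3) show ?thesis by simp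
qed

lemma C1_onI:
  fixes F :: "'a::euclidean_space \<Rightarrow> real"
  assumes "\<And>i x. i \<in> Basis \<Longrightarrow> x \<noteq> 0 \<Longrightarrow> ((\<lambda>t. F (x + t *\<^sub>R i)) has_real_derivative P i x) (at 0)"
    and "\<And>i. i \<in> Basis \<Longrightarrow> continuous_on (- {0}) (P i)"
  shows "C1_on (- {0}) F"
  unfolding C1_on_def
proof (intro ballI conjI)
  fix i :: 'a assume i: "i \<in> Basis"
  show "(\<lambda>t. F (x + t *\<^sub>R i)) differentiable (at 0)" if "x \<in> - {0}" for x
    using assms(1)[OF i, of x] that by (auto simp: real_differentiable_def)
  show "continuous_on (- {0}) (partial_deriv i F)"
  proof (rule continuous_on_eq[OF assms(2)[OF i]])
    fix x :: 'a assume "x \<in> - {0}"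
    then show "P i x = partial_deriv i F x"
      using assms(1)[OF i, of x] by (simp add: partial_deriv_def DERIV_imp_deriv)
  qed
qed

context
  fixes f f' f'' :: "real \<Rightarrow> real" and w :: "'a::euclidean_space \<Rightarrow> real"
  assumes f: "second_derivs f f' f''"
  defines "w \<equiv> \<lambda>x. f (ln (norm x))"
begin

text \<open>The first partial derivatives of \<open>x \<mapsto> f (ln |x|)\<close> away from the origin, and below the
  second ones.\<close>

definition radial_deriv :: "'a \<Rightarrow> 'a \<Rightarrow> real" where
  "radial_deriv i x = f' (ln (norm x)) * ((x \<bullet> i) / (x \<bullet> x))"

definition radial_deriv2 :: "'a \<Rightarrow> 'a \<Rightarrow> 'a \<Rightarrow> real" where
  "radial_deriv2 i j x = f'' (ln (norm x)) * ((x \<bullet> j) / (x \<bullet> x)) * ((x \<bullet> i) / (x \<bullet> x))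
     + f' (ln (norm x)) * ((i \<bullet> j) / (x \<bullet> x) - 2 * (x \<bullet> i) * (x \<bullet> j) / (x \<bullet> x)\<^sup>2)"

lemma line_derivative_radial:
  "x \<noteq> 0 \<Longrightarrow> ((\<lambda>t. w (x + t *\<^sub>R i)) has_real_derivative radial_deriv i x) (at 0)"
  unfolding w_def radial_deriv_def
  by (rule DERIV_chain2[OF _ has_real_derivative_line_ln_norm])
     (use f in \<open>auto simp: second_derivs_def\<close>)

lemma partial_deriv_radial: "x \<noteq> 0 \<Longrightarrow> partial_deriv i w x = radial_deriv i x"
  unfolding partial_deriv_def by (rule DERIV_imp_deriv[OF line_derivative_radial])

lemma line_derivative_radial_deriv:
  assumes "x \<noteq> 0"
  shows "((\<lambda>t. radial_deriv i (x + t *\<^sub>R j)) has_real_derivative radial_deriv2 i j x) (at 0)"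
proof -
  have A: "((\<lambda>t. f' (ln (norm (x + t *\<^sub>R j)))) has_real_derivative f'' (ln (norm x)) * ((x \<bullet> j) / (x \<bullet> x))) (at 0)"
    by (rule DERIV_chain2[OF _ has_real_derivative_line_ln_norm[OF assms]])
       (use f in \<open>auto simp: second_derivs_def\<close>)
  have xx: "x \<bullet> x \<noteq> 0" using assms by simp
  have "((\<lambda>t. (x \<bullet> i + t * (i \<bullet> j)) / (x \<bullet> x + 2 * t * (x \<bullet> j) + t\<^sup>2 * (j \<bullet> j)))
      has_real_derivative (i \<bullet> j) / (x \<bullet> x) - 2 * (x \<bullet> i) * (x \<bullet> j) / (x \<bullet> x)\<^sup>2) (at 0)"
    using xx by (auto intro!: derivative_eq_intros simp: field_simps power2_eq_square)
  moreover have "(\<lambda>t. (x \<bullet> i + t * (i \<bullet> j)) / (x \<bullet> x + 2 * t * (x \<bullet> j) + t\<^sup>2 * (j \<bullet> j)))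
      = (\<lambda>t. ((x + t *\<^sub>R j) \<bullet> i) / ((x + t *\<^sub>R j) \<bullet> (x + t *\<^sub>R j)))"
    by (auto simp: inner_add_left inner_add_right inner_commute power2_eq_square algebra_simps)
  ultimately have B: "((\<lambda>t. ((x + t *\<^sub>R j) \<bullet> i) / ((x + t *\<^sub>R j) \<bullet> (x + t *\<^sub>R j)))
      has_real_derivative (i \<bullet> j) / (x \<bullet> x) - 2 * (x \<bullet> i) * (x \<bullet> j) / (x \<bullet> x)\<^sup>2) (at 0)"
    by simp
  show ?thesis
    unfolding radial_deriv_def radial_deriv2_def
    by (rule DERIV_cong[OF DERIV_mult[OF A B]]) simp
qed

lemma line_derivative_partial_deriv_radial:
  assumes "x \<noteq> 0"
  shows "((\<lambda>t. partial_deriv i w (x + t *\<^sub>R j)) has_real_derivative radial_deriv2 i j x) (at 0)"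
  by (rule line_derivative_cong[OF assms partial_deriv_radial[symmetric] line_derivative_radial_deriv[OF assms]])

lemma C2_on_radial: "C2_on (- {0}) w"
proof -
  have c: "continuous_on UNIV f'" "continuous_on UNIV f''"
    using f by (auto simp: second_derivs_def intro!: continuous_at_imp_continuous_on DERIV_isCont)
  have ln: "continuous_on (- {0}) (\<lambda>x::'a. ln (norm x))"
    by (auto intro!: continuous_intros)
  note cl = continuous_on_compose2[OF c(1) ln] continuous_on_compose2[OF c(2) ln]
  show ?thesis
    unfolding C2_on_def
  proof (intro conjI ballI)
    show "C1_on (- {0}) w"
    proof (rule C1_onI)
      show "((\<lambda>t. w (x + t *\<^sub>R i)) has_real_derivative radial_deriv i x) (at 0)" if "x \<noteq> 0" for i x
        by (rule line_derivative_radial[OF that])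
      show "continuous_on (- {0}) (radial_deriv i)" for i
        unfolding radial_deriv_def[abs_def] by (intro continuous_intros cl) auto
    qed
    fix i :: 'a
    show "C1_on (- {0}) (partial_deriv i w)"
    proof (rule C1_onI)
      show "((\<lambda>t. partial_deriv i w (x + t *\<^sub>R j)) has_real_derivative radial_deriv2 i j x) (at 0)" if "x \<noteq> 0" for j x
        by (rule line_derivative_partial_deriv_radial[OF that])
      show "continuous_on (- {0}) (radial_deriv2 i j)" for j
        unfolding radial_deriv2_def[abs_def] by (intro continuous_intros cl) auto
    qed
  qed
qed

lemma laplacian_radial:
  assumes "x \<noteq> 0"
  shows "laplacian w x = (f'' (ln (norm x)) + (real DIM('a) - 2) * f' (ln (norm x))) / (x \<bullet> x)"
proof -
  have xx: "x \<bullet> x \<noteq> 0" using assms by simp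
  have "laplacian w x = (\<Sum>i\<in>Basis. radial_deriv2 i i x)"
    unfolding laplacian_def partial_deriv_def[of _ "partial_deriv _ w"]
    by (intro sum.cong refl DERIV_imp_deriv line_derivative_partial_deriv_radial assms)
  also have "\<dots> = (\<Sum>i\<in>Basis. (f'' (ln (norm x)) - 2 * f' (ln (norm x))) / (x \<bullet> x)\<^sup>2 * ((x \<bullet> i) * (x \<bullet> i))
      + f' (ln (norm x)) / (x \<bullet> x))"
  proof (intro sum.cong refl)
    fix i :: 'a assume i: "i \<in> Basis"
    have "A * (c / X) * (c / X) + B * (1 / X - 2 * c * c / X\<^sup>2) = (A - 2 * B) / X\<^sup>2 * (c * c) + B / X"
      if "X \<noteq> 0" for A B c X :: real
      using that by (simp add: field_simps power2_eq_square)
    from this[OF xx] show "radial_deriv2 i i x = (f'' (ln (norm x)) - 2 * f' (ln (norm x))) / (x \<bullet> x)\<^sup>2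
        * ((x \<bullet> i) * (x \<bullet> i)) + f' (ln (norm x)) / (x \<bullet> x)"
      using i by (simp add: radial_deriv2_def inner_same_Basis)
  qed
  also have "\<dots> = (f'' (ln (norm x)) - 2 * f' (ln (norm x))) / (x \<bullet> x)\<^sup>2 * (x \<bullet> x)
      + real DIM('a) * (f' (ln (norm x)) / (x \<bullet> x))"
    by (simp only: sum.distrib sum_distrib_left[symmetric] euclidean_inner[symmetric] sum_constant)
  also have "\<dots> = (f'' (ln (norm x)) + (real DIM('a) - 2) * f' (ln (norm x))) / (x \<bullet> x)"
    using xx by (simp add: field_simps power2_eq_square)
  finally show ?thesis .
qed

end

text \<open>Polar coordinates for radial functions: the image of Lebesgue measure under \<open>- ln |x|\<close> has an
  exponential density. With the minus sign the half lines \<open>{r<..}\<close> correspond to balls and so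
  have finite measure, which makes them a determining class.\<close>

lemma distr_neg_ln_norm:
  "distr lborel borel (\<lambda>x::'a::euclidean_space. - ln (norm x))
   = density lborel (\<lambda>t. ennreal (real DIM('a) * unit_ball_vol (real DIM('a)) * exp (- (real DIM('a) * t))))"
  (is "?M = ?N")
proof -
  let ?n = "real DIM('a)" let ?V = "unit_ball_vol (real DIM('a))"
  have n: "?n > 0" by simp
  have M: "emeasure ?M {r<..} = ennreal (?V * exp (- (?n * r)))" for r
  proof -
    have "emeasure ?M {r<..} = emeasure lborel {x::'a. r < - ln (norm x)}"
      by (subst emeasure_distr) (auto intro!: arg_cong[where f = "emeasure lborel"])
    also have "\<dots> = emeasure lborel (ball (0::'a) (exp (- r)))"
    proof (rule emeasure_eq_AE)
      show "AE x in lborel. (x \<in> {x::'a. r < - ln (norm x)}) = (x \<in> ball 0 (exp (- r)))"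
        using AE_lborel_singleton[of "0::'a"]
      proof eventually_elim
        case (elim x)
        then have "r < - ln (norm x) \<longleftrightarrow> ln (norm x) < ln (exp (- r))" by auto
        also have "\<dots> \<longleftrightarrow> norm x < exp (- r)" using elim by (subst ln_less_cancel_iff) auto
        finally show ?case by simp
      qed
    qed auto
    also have "\<dots> = ennreal (?V * exp (- r) ^ DIM('a))"
      by (subst emeasure_ball) auto
    also have "exp (- r) ^ DIM('a) = exp (- (?n * r))"
      by (simp flip: exp_of_nat_mult)
    finally show ?thesis .
  qed
  have N: "emeasure ?N {r<..} = ennreal (?V * exp (- (?n * r)))" for r
  proof -
    have "emeasure ?N {r<..} = (\<integral>\<^sup>+t. ennreal (?n * ?V * exp (- (?n * t))) * indicator {r<..} t \<partial>lborel)"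
      by (subst emeasure_density) auto
    also have "\<dots> = (\<integral>\<^sup>+t. ennreal (?n * ?V * exp (- (?n * t))) * indicator {r..} t \<partial>lborel)"
      by (rule nn_integral_cong_AE, rule AE_mp[OF AE_lborel_singleton[of r]])
         (auto simp: indicator_def)
    also have "\<dots> = ennreal (0 - (- ?V * exp (- (?n * r))))"
    proof (rule nn_integral_FTC_atLeast)
      have "((\<lambda>t. exp (- (?n * t))) \<longlongrightarrow> 0) at_top" using n by real_asymp
      from tendsto_mult_left[OF this, of "- ?V"]
      show "((\<lambda>t. - ?V * exp (- (?n * t))) \<longlongrightarrow> 0) at_top" by simp
      show "((\<lambda>t. - ?V * exp (- (?n * t))) has_real_derivative ?n * ?V * exp (- (?n * x))) (at x)"
        for x by (auto intro!: derivative_eq_intros)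
    qed auto
    finally show ?thesis by simp
  qed
  show ?thesis
    by (rule measure_eqI_lessThan) (auto simp: M N)
qed

lemma nn_integral_radial:
  fixes \<psi> :: "real \<Rightarrow> ennreal"
  assumes [measurable]: "\<psi> \<in> borel_measurable borel"
  shows "(\<integral>\<^sup>+x. \<psi> (ln (norm x)) \<partial>(lborel :: 'a::euclidean_space measure))
    = (\<integral>\<^sup>+t. ennreal (real DIM('a) * unit_ball_vol (real DIM('a)) * exp (real DIM('a) * t)) * \<psi> t \<partial>lborel)"
proof -
  let ?c = "real DIM('a) * unit_ball_vol (real DIM('a))"
  have "(\<integral>\<^sup>+x. \<psi> (ln (norm x)) \<partial>(lborel :: 'a measure)) = (\<integral>\<^sup>+t. \<psi> (- t) \<partial>distr lborel borel (\<lambda>x::'a. - ln (norm x)))"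
    by (subst nn_integral_distr) auto
  also have "\<dots> = (\<integral>\<^sup>+t. ennreal (?c * exp (- (real DIM('a) * t))) * \<psi> (- t) \<partial>lborel)"
    unfolding distr_neg_ln_norm by (subst nn_integral_density) auto
  also have "\<dots> = (\<integral>\<^sup>+t. ennreal (?c * exp (real DIM('a) * t)) * \<psi> t \<partial>lborel)"
    using nn_integral_real_reflect[of "\<lambda>t. ennreal (?c * exp (real DIM('a) * t)) * \<psi> t" 0] by simp
  finally show ?thesis .
qed


section \<open>The solution on the punctured space\<close>

lemma second_derivs_exp_mult:
  assumes "second_derivs f f' f''"
  shows "second_derivs (\<lambda>t. exp (- c * t) * f t) (\<lambda>t. exp (- c * t) * (f' t - c * f t))
    (\<lambda>t. exp (- c * t) * (f'' t - 2 * c * f' t + c\<^sup>2 * f t))"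
proof -
  have f: "(f has_real_derivative f' t) (at t)" "(f' has_real_derivative f'' t) (at t)" for t
    using assms by (auto simp: second_derivs_def)
  have c: "continuous_on UNIV f" "continuous_on UNIV f'" "continuous_on UNIV f''"
    using assms by (auto simp: second_derivs_def intro!: continuous_at_imp_continuous_on DERIV_isCont)
  show ?thesis
    unfolding second_derivs_def
  proof (intro conjI allI)
    show "((\<lambda>t. exp (- c * t) * f t) has_real_derivative exp (- c * t) * (f' t - c * f t)) (at t)" for t
      by (rule derivative_eq_intros f refl | simp)+ (simp add: algebra_simps)
    show "((\<lambda>t. exp (- c * t) * (f' t - c * f t)) has_real_derivative
        exp (- c * t) * (f'' t - 2 * c * f' t + c\<^sup>2 * f t)) (at t)" for t
      by (rule derivative_eq_intros f refl | simp)+ (simp add: algebra_simps power2_eq_square)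
  qed (intro continuous_intros c)
qed

text \<open>The radial function \<open>|x|\<^sup>-\<^sup>c f(ln |x|)\<close>.\<close>

definition power_lift :: "real \<Rightarrow> (real \<Rightarrow> real) \<Rightarrow> 'a::euclidean_space \<Rightarrow> real" where
  "power_lift c f x = exp (- c * ln (norm x)) * f (ln (norm x))"

lemma radial_power_lift: "radial (power_lift c f)"
  by (simp add: radial_def power_lift_def)

lemma
  fixes f :: "real \<Rightarrow> real"
  assumes "second_derivs f f' f''" and dim: "b + c = real DIM('a::euclidean_space) - 2"
  shows C2_on_power_lift: "C2_on (- {0}) (power_lift c f :: 'a \<Rightarrow> real)"
    and laplacian_power_lift: "x \<noteq> 0 \<Longrightarrow> laplacian (power_lift c f) (x :: 'a) =
      exp (- (c + 2) * ln (norm x)) *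
      (f'' (ln (norm x)) + (b - c) * f' (ln (norm x)) - b * c * f (ln (norm x)))"
proof -
  note sd = second_derivs_exp_mult[OF assms(1), of c]
  have eq: "(power_lift c f :: 'a \<Rightarrow> real) = (\<lambda>x. (\<lambda>t. exp (- c * t) * f t) (ln (norm x)))"
    by (simp add: power_lift_def fun_eq_iff)
  show "C2_on (- {0}) (power_lift c f :: 'a \<Rightarrow> real)"
    unfolding eq by (rule C2_on_radial[OF sd])
  assume x: "x \<noteq> 0"
  define t where "t = ln (norm x)"
  have xx: "x \<bullet> x = exp (2 * t)"
    using x by (simp add: t_def dot_square_norm exp_double)
  have "laplacian (power_lift c f) x
      = (exp (- c * t) * (f'' t - 2 * c * f' t + c\<^sup>2 * f t)
        + (b + c) * (exp (- c * t) * (f' t - c * f t))) / exp (2 * t)"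
    unfolding eq laplacian_radial[OF sd x] dim t_def[symmetric] xx by simp
  also have "\<dots> = (exp (- c * t) / exp (2 * t)) * (f'' t + (b - c) * f' t - b * c * f t)"
    by (simp add: field_simps power2_eq_square)
  also have "exp (- c * t) / exp (2 * t) = exp (- (c + 2) * t)"
    by (simp add: exp_diff[symmetric] algebra_simps)
  finally show "laplacian (power_lift c f) x = exp (- (c + 2) * ln (norm x)) *
      (f'' (ln (norm x)) + (b - c) * f' (ln (norm x)) - b * c * f (ln (norm x)))"
    by (simp add: t_def)
qed

lemma power_lift_tendsto_0:
  assumes "(f \<longlongrightarrow> 0) at_top" "(f \<longlongrightarrow> 0) at_bot"
  shows "((\<lambda>x::'a::euclidean_space. norm x powr c * power_lift c f x) \<longlongrightarrow> 0) at_infinity"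
    and "((\<lambda>x::'a::euclidean_space. norm x powr c * power_lift c f x) \<longlongrightarrow> 0) (at 0)"
proof -
  have eq: "f (ln (norm x)) = norm x powr c * power_lift c f x" if "x \<noteq> 0" for x :: 'a
    using that by (simp add: power_lift_def powr_def mult.assoc[symmetric] flip: exp_add)
  have "filterlim (\<lambda>x::'a. ln (norm x)) at_top at_infinity"
    by (rule filterlim_compose[OF ln_at_top filterlim_norm_at_top])
  then have "((\<lambda>x::'a. f (ln (norm x))) \<longlongrightarrow> 0) at_infinity"
    by (rule filterlim_compose[OF assms(1)])
  moreover have "\<forall>\<^sub>F x::'a in at_infinity. x \<noteq> 0"
    by (auto simp: eventually_at_infinity intro!: exI[of _ 1])
  ultimately show "((\<lambda>x::'a. norm x powr c * power_lift c f x) \<longlongrightarrow> 0) at_infinity"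
    using eq by (auto elim!: Lim_transform_eventually eventually_mono)
  have "filterlim (\<lambda>x::'a. norm x) (at_right 0) (at 0)"
    by (auto simp: filterlim_at eventually_at_filter intro!: tendsto_eq_intros)
  then have "filterlim (\<lambda>x::'a. ln (norm x)) at_bot (at 0)"
    by (rule filterlim_compose[OF ln_at_0])
  then have "((\<lambda>x::'a. f (ln (norm x))) \<longlongrightarrow> 0) (at 0)"
    by (rule filterlim_compose[OF assms(2)])
  moreover have "\<forall>\<^sub>F x::'a in at 0. x \<noteq> 0"
    by (simp add: eventually_at_filter)
  ultimately show "((\<lambda>x::'a. norm x powr c * power_lift c f x) \<longlongrightarrow> 0) (at 0)"
    using eq by (auto elim!: Lim_transform_eventually eventually_mono)
qed

lemma signed_pow_mult:
  assumes "\<bar>\<theta>\<bar> = 1" "0 \<le> x" shows "signed_pow (p - 2) (\<theta> * x) = \<theta> * x powr (p - 1)"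
  using powr_minus_one_mult[OF assms(2), of "p - 1"] assms
  by (simp add: signed_pow_def abs_mult algebra_simps)

text \<open>The choice \<open>c = (a + n) / p\<close> is the one for which the nonlinearity has the same homogeneity as
  the Laplacian of the other component, whose exponent is \<open>e = n - 2 - c\<close>.\<close>

lemma nonlinearity_power_lift:
  assumes "\<bar>\<theta>\<bar> = 1" "p > 1" "c = (a + n) / p" "c + e = n - 2" "\<And>t. 0 \<le> g t" "x \<noteq> 0"
  shows "norm x powr a * signed_pow (p - 2) (\<theta> * power_lift c g x)
    = \<theta> * exp (- (e + 2) * ln (norm x)) * g (ln (norm x)) powr (p - 1)"
proof -
  define t where "t = ln (norm x)"
  have "c * p = a + n" using assms by simp
  then have ex: "a * t + (- c * t) * (p - 1) = - (e + 2) * t"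
    using assms(4) by algebra
  have "norm x powr a * signed_pow (p - 2) (\<theta> * power_lift c g x)
      = exp (a * t) * (\<theta> * (exp (- c * t) * g t) powr (p - 1))"
    using assms by (subst signed_pow_mult) (auto simp: power_lift_def powr_def t_def)
  also have "\<dots> = \<theta> * (exp (a * t) * exp ((- c * t) * (p - 1))) * g t powr (p - 1)"
    by (simp add: powr_mult exp_powr_real)
  also have "exp (a * t) * exp ((- c * t) * (p - 1)) = exp (- (e + 2) * t)"
    by (simp only: exp_add[symmetric] ex)
  finally show ?thesis by (simp add: t_def)
qed

text \<open>With these exponents the energy integrand is \<open>|x|\<^sup>-\<^sup>n g(ln |x|)\<^sup>p\<close>, and the power of \<open>|x|\<close> cancels
  the density of polar coordinates.\<close>

lemma finite_energy:
  fixes L :: "'a::euclidean_space \<Rightarrow> real"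
  assumes p: "p > 1" and c: "c = (a + real DIM('a)) / p" "c + e = real DIM('a) - 2" "\<bar>\<theta>\<bar> = 1"
    and g: "\<And>t. 0 \<le> g t" "integrable lborel (\<lambda>t. g t powr p)"
    and L: "\<And>x. x \<noteq> 0 \<Longrightarrow> L x = \<theta> * exp (- (e + 2) * ln (norm x)) * g (ln (norm x)) powr (p - 1)"
  shows "(\<integral>\<^sup>+x\<in>- {0}. ennreal (norm x powr (- a / (p - 1)) * \<bar>L x\<bar> powr (p / (p - 1))) \<partial>lborel) < \<infinity>"
proof -
  let ?n = "real DIM('a)" and ?V = "real DIM('a) * unit_ball_vol (real DIM('a))"
  have [measurable]: "(\<lambda>t. g t powr p) \<in> borel_measurable borel" using g(2) by auto
  have V: "0 \<le> ?V" by simp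
  have pw: "norm x powr (- a / (p - 1)) * \<bar>L x\<bar> powr (p / (p - 1))
      = exp (- ?n * ln (norm x)) * g (ln (norm x)) powr p" if "x \<noteq> 0" for x
  proof -
    define t where "t = ln (norm x)"
    have "c * p = a + ?n" using c p by simp
    then have num: "- a + (- (e + 2)) * p = - ?n * (p - 1)" using c(2) by algebra
    have ex: "- a / (p - 1) + (- (e + 2)) * (p / (p - 1)) = - ?n"
    proof -
      have "- a / (p - 1) + (- (e + 2)) * (p / (p - 1)) = (- a + (- (e + 2)) * p) / (p - 1)"
        by (simp add: add_divide_distrib diff_divide_distrib)
      also have "\<dots> = - ?n"
        unfolding num using p by simp
      finally show ?thesis .
    qed
    have "\<bar>L x\<bar> = exp (- (e + 2) * t) * g t powr (p - 1)"
      using L[OF that] c(3) by (simp add: abs_mult t_def)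
    then have "\<bar>L x\<bar> powr (p / (p - 1)) = exp ((- (e + 2) * t) * (p / (p - 1))) * g t powr p"
      using p by (simp add: powr_mult powr_powr exp_powr_real)
    then have "norm x powr (- a / (p - 1)) * \<bar>L x\<bar> powr (p / (p - 1))
        = exp (- a / (p - 1) * t) * exp ((- (e + 2) * t) * (p / (p - 1))) * g t powr p"
      using that by (simp add: powr_def t_def)
    also have "exp (- a / (p - 1) * t) * exp ((- (e + 2) * t) * (p / (p - 1)))
        = exp ((- a / (p - 1) + (- (e + 2)) * (p / (p - 1))) * t)"
      by (simp only: exp_add[symmetric] distrib_right) (simp add: mult_ac)
    finally show ?thesis unfolding ex t_def .
  qed
  have "(\<integral>\<^sup>+x\<in>- {0}. ennreal (norm x powr (- a / (p - 1)) * \<bar>L x\<bar> powr (p / (p - 1))) \<partial>lborel)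
      \<le> (\<integral>\<^sup>+x. ennreal (exp (- ?n * ln (norm x)) * g (ln (norm x)) powr p) \<partial>(lborel :: 'a measure))"
  proof (intro nn_integral_mono)
    fix x :: 'a
    show "ennreal (norm x powr (- a / (p - 1)) * \<bar>L x\<bar> powr (p / (p - 1))) * indicator (- {0}) x
        \<le> ennreal (exp (- ?n * ln (norm x)) * g (ln (norm x)) powr p)"
    proof (cases "x = 0")
      case False
      show ?thesis unfolding pw[OF False] using False by simp
    qed simp
  qed
  also have "\<dots> = (\<integral>\<^sup>+t. ennreal (?V * exp (?n * t)) * ennreal (exp (- ?n * t) * g t powr p) \<partial>lborel)"
    by (rule nn_integral_radial) measurable
  also have "\<dots> = (\<integral>\<^sup>+t. ennreal (?V * g t powr p) \<partial>lborel)"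
  proof (intro nn_integral_cong)
    fix t
    have "?V * exp (?n * t) * (exp (- ?n * t) * g t powr p) = ?V * (exp (?n * t) * exp (- ?n * t)) * g t powr p"
      by simp
    also have "exp (?n * t) * exp (- ?n * t) = 1" by (simp flip: exp_add)
    finally show "ennreal (?V * exp (?n * t)) * ennreal (exp (- ?n * t) * g t powr p) = ennreal (?V * g t powr p)"
      using V by (subst ennreal_mult[symmetric]) auto
  qed
  also have "\<dots> = ennreal (\<integral>t. ?V * g t powr p \<partial>lborel)"
    using g(2) V by (intro nn_integral_eq_integral) auto
  also have "\<dots> < \<infinity>" by simp
  finally show ?thesis .
qed

lemma second_derivs_cmult:
  assumes "second_derivs f f' f''"
  shows "second_derivs (\<lambda>t. c * f t) (\<lambda>t. c * f' t) (\<lambda>t. c * f'' t)"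
  using assms by (auto simp: second_derivs_def intro!: DERIV_cmult continuous_intros)

theorem mainTheorem1:
  fixes n :: nat and a b p q :: real
  assumes "n = CARD('n::finite)" and "n \<ge> 2"
    and "a \<noteq> - real n" and "b \<noteq> - real n"
    and "p > 1" and "q > 1"
    and "(a + real n) / p + (b + real n) / q = real n - 2"
    and "1 / p + 1 / q < 1"
  shows "\<exists>u v :: real ^ 'n \<Rightarrow> real.
      radial_solution a b p q u v \<and>
      (\<exists>x. x \<noteq> 0 \<and> (u x \<noteq> 0 \<or> v x \<noteq> 0)) \<and>
      (\<integral>\<^sup>+x\<in>- {0}. ennreal (norm x powr (- a / (p - 1)) *
          \<bar>laplacian u x\<bar> powr (p / (p - 1))) \<partial>lborel) < \<infinity> \<and>
      (\<integral>\<^sup>+x\<in>- {0}. ennreal (norm x powr (- b / (q - 1)) *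
          \<bar>laplacian v x\<bar> powr (q / (q - 1))) \<partial>lborel) < \<infinity> \<and>
      ((\<lambda>x. norm x powr ((b + real n) / q) * u x) \<longlongrightarrow> 0) at_infinity \<and>
      ((\<lambda>x. norm x powr ((b + real n) / q) * u x) \<longlongrightarrow> 0) (at 0) \<and>
      ((\<lambda>x. norm x powr ((a + real n) / p) * v x) \<longlongrightarrow> 0) at_infinity \<and>
      ((\<lambda>x. norm x powr ((a + real n) / p) * v x) \<longlongrightarrow> 0) (at 0) \<and>
      ((\<forall>x. x \<noteq> 0 \<longrightarrow> u x > 0 \<and> v x > 0) \<longleftrightarrow> a > - real n \<and> b > - real n)"
proof -
  define \<alpha> \<beta> where "\<alpha> = (a + real n) / p" and "\<beta> = (b + real n) / q"
  define \<theta> where "\<theta> = sgn (\<alpha> * \<beta>)"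
  have nz: "\<alpha> \<noteq> 0" "\<beta> \<noteq> 0" and sum: "\<alpha> + \<beta> = real n - 2"
    using assms by (auto simp: \<alpha>_def \<beta>_def)
  have \<theta>: "\<bar>\<theta>\<bar> = 1" "\<theta> * \<theta> = 1" using nz by (auto simp: \<theta>_def sgn_if)
  have dim: "real DIM(real ^ 'n) = real n" using assms(1) by simp
  have sign_iff: "\<alpha> > 0 \<longleftrightarrow> a > - real n" "\<beta> > 0 \<longleftrightarrow> b > - real n"
    using assms(5,6) by (auto simp: \<alpha>_def \<beta>_def zero_less_divide_iff)
  obtain f f' f'' g g' g'' where sd: "second_derivs f f' f''" "second_derivs g g' g''"
    and ode: "\<And>t. f'' t + (\<alpha> - \<beta>) * f' t - \<alpha> * \<beta> * f t = - sgn (\<alpha> * \<beta>) * g t powr (p - 1)"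
      "\<And>t. g'' t + (\<beta> - \<alpha>) * g' t - \<alpha> * \<beta> * g t = - sgn (\<alpha> * \<beta>) * f t powr (q - 1)"
    and nn: "\<And>t. 0 \<le> f t" "\<And>t. 0 \<le> g t" and f0: "f 0 > 0"
    and pos: "\<alpha> > 0 \<and> \<beta> > 0 \<longrightarrow> (\<forall>t. f t > 0 \<and> g t > 0)"
    and int: "integrable lborel (\<lambda>t. g t powr p)" "integrable lborel (\<lambda>t. f t powr q)"
    and lim: "(f \<longlongrightarrow> 0) at_top" "(f \<longlongrightarrow> 0) at_bot" "(g \<longlongrightarrow> 0) at_top" "(g \<longlongrightarrow> 0) at_bot"
    by (rule exists_homoclinic[OF nz assms(5,6,8)]) (rule that; assumption)
  define u :: "real ^ 'n \<Rightarrow> real" where "u = power_lift \<beta> f"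
  define v :: "real ^ 'n \<Rightarrow> real" where "v = power_lift \<alpha> (\<lambda>t. \<theta> * g t)"
  note sdv = second_derivs_cmult[OF sd(2), of \<theta>]
  have dims: "\<alpha> + \<beta> = real DIM(real ^ 'n) - 2" "\<beta> + \<alpha> = real DIM(real ^ 'n) - 2"
    using sum dim by auto
  have lap_u: "laplacian u x = - \<theta> * exp (- (\<beta> + 2) * ln (norm x)) * g (ln (norm x)) powr (p - 1)"
    if "x \<noteq> 0" for x
    unfolding u_def laplacian_power_lift[OF sd(1) dims(1) that] ode(1) \<theta>_def by simp
  have lap_v: "laplacian v x = - 1 * exp (- (\<alpha> + 2) * ln (norm x)) * f (ln (norm x)) powr (q - 1)"
    if "x \<noteq> 0" for x
  proof -
    have "\<theta> * g'' t + (\<beta> - \<alpha>) * (\<theta> * g' t) - \<beta> * \<alpha> * (\<theta> * g t) = - (f t powr (q - 1))" for t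
    proof -
      have "\<theta> * g'' t + (\<beta> - \<alpha>) * (\<theta> * g' t) - \<beta> * \<alpha> * (\<theta> * g t)
          = \<theta> * (g'' t + (\<beta> - \<alpha>) * g' t - \<alpha> * \<beta> * g t)"
        by (simp add: algebra_simps)
      also have "\<dots> = - (\<theta> * \<theta>) * f t powr (q - 1)"
        unfolding ode(2) \<theta>_def by simp
      finally show ?thesis using \<theta>(2) by simp
    qed
    then show ?thesis
      unfolding v_def laplacian_power_lift[OF sdv dims(2) that] by simp
  qed
  have v_eq: "v x = \<theta> * power_lift \<alpha> g x" for x
    by (simp add: v_def power_lift_def)
  have "radial_solution a b p q u v"
    unfolding radial_solution_def
  proof (intro conjI allI impI)
    show "radial u" "radial v" unfolding u_def v_def by (rule radial_power_lift)+
    show "C2_on (- {0}) u" unfolding u_def by (rule C2_on_power_lift[OF sd(1) dims(1)])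
    show "C2_on (- {0}) v" unfolding v_def by (rule C2_on_power_lift[OF sdv dims(2)])
    fix x :: "real ^ 'n" assume x: "x \<noteq> 0"
    show "- laplacian u x = norm x powr a * signed_pow (p - 2) (v x)"
      unfolding lap_u[OF x] v_eq
      using nonlinearity_power_lift[OF \<theta>(1) assms(5) \<alpha>_def sum nn(2) x] by simp
    show "- laplacian v x = norm x powr b * signed_pow (q - 2) (u x)"
      unfolding lap_v[OF x] u_def
      using nonlinearity_power_lift[OF _ assms(6) \<beta>_def _ nn(1) x, of 1 \<alpha>] sum by simp
  qed
  moreover have "\<exists>x. x \<noteq> 0 \<and> (u x \<noteq> 0 \<or> v x \<noteq> 0)"
  proof -
    obtain e :: "real ^ 'n" where "e \<in> Basis" using nonempty_Basis by blast
    then have "e \<noteq> 0" "u e \<noteq> 0" using f0 by (auto simp: u_def power_lift_def)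
    then show ?thesis by blast
  qed
  moreover have "(\<integral>\<^sup>+x\<in>- {0}. ennreal (norm x powr (- a / (p - 1)) *
          \<bar>laplacian u x\<bar> powr (p / (p - 1))) \<partial>lborel) < \<infinity>"
    by (rule finite_energy[where \<theta> = "- \<theta>", OF assms(5) _ dims(1) _ nn(2) int(1) lap_u])
       (use \<alpha>_def dim \<theta> in auto)
  moreover have "(\<integral>\<^sup>+x\<in>- {0}. ennreal (norm x powr (- b / (q - 1)) *
          \<bar>laplacian v x\<bar> powr (q / (q - 1))) \<partial>lborel) < \<infinity>"
    by (rule finite_energy[where \<theta> = "- 1", OF assms(6) _ dims(2) _ nn(1) int(2) lap_v])
       (use \<beta>_def dim in auto)
  moreover have "((\<lambda>t. \<theta> * g t) \<longlongrightarrow> 0) at_top" "((\<lambda>t. \<theta> * g t) \<longlongrightarrow> 0) at_bot"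
    using tendsto_mult_left[OF lim(3), of \<theta>] tendsto_mult_left[OF lim(4), of \<theta>] by auto
  note power_lift_tendsto_0[OF lim(1,2), of \<beta>, where 'a = "real ^ 'n", folded u_def]
    power_lift_tendsto_0[OF this, of \<alpha>, where 'a = "real ^ 'n", folded v_def]
  moreover have "(\<forall>x. x \<noteq> 0 \<longrightarrow> u x > 0 \<and> v x > 0) \<longleftrightarrow> a > - real n \<and> b > - real n"
  proof
    assume L: "\<forall>x. x \<noteq> 0 \<longrightarrow> u x > 0 \<and> v x > 0"
    obtain e :: "real ^ 'n" where "e \<in> Basis" using nonempty_Basis by blast
    then have "v e > 0" using L nonzero_Basis by blast
    then have "\<theta> * g (ln (norm e)) > 0" by (simp add: v_def power_lift_def zero_less_mult_iff)
    then have "\<theta> > 0" using nn(2)[of "ln (norm e)"] by (auto simp: zero_less_mult_iff)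
    then have "\<alpha> * \<beta> > 0" by (simp add: \<theta>_def)
    then have "\<alpha> > 0 \<and> \<beta> > 0" using sum assms(2) by (auto simp: zero_less_mult_iff)
    then show "a > - real n \<and> b > - real n" using sign_iff by simp
  next
    assume "a > - real n \<and> b > - real n"
    then have p: "\<alpha> > 0" "\<beta> > 0" using sign_iff by auto
    then have "\<theta> = 1" by (simp add: \<theta>_def)
    then show "\<forall>x. x \<noteq> 0 \<longrightarrow> u x > 0 \<and> v x > 0"
      using pos p by (simp add: u_def v_def power_lift_def)
  qed
  ultimately show ?thesis unfolding \<alpha>_def \<beta>_def by blast
qed

end
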